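(* Given a tensor $\mathcal{A}\in\mathbb{R}^{I_1\times\cdots\times I_d}$. Assume that the rank-$r_k$ approximation error of its $k$th unfolding matrix $\mathbf{A}_k\in\mathbb{R}^{(I_1\cdots I_k)\times(I_{k+1}\cdots I_d)}$ from the URV decomposition is $\varepsilon_k$, that is, $$\mathbf{A}_k=\begin{bmatrix}\mathbf{U}^{(k)}_1&\mathbf{U}^{(k)}_2\end{bmatrix}\begin{bmatrix}\mathbf{R}^{(k)}_{11}&\mathbf{R}^{(k)}_{12}\\ \mathbf{O}&\mathbf{R}^{(k)}_{22}\end{bmatrix}\begin{bmatrix}\mathbf{V}^{(k)\top}_1\\ \mathbf{V}^{(k)\top}_2\end{bmatrix}=\mathbf{U}^{(k)}_1\mathbf{R}^{(k)}_{11}\mathbf{V}^{(k)\top}_1+\mathbf{E}^{(k)},$$ where $\mathbf{R}^{(k)}_{11}\in\mathbb{R}^{r_k\times r_k}$, $\mathbf{E}^{(k)}=(\mathbf{U}^{(k)}_1\mathbf{R}^{(k)}_{12}+\mathbf{U}^{(k)}_2\mathbf{R}^{(k)}_{22})\mathbf{V}^{(k)\top}_2$, and $\|\mathbf{E}^{(k)}\|_F=\varepsilon_k$ for all $k=1,\dots,d-1$. Then the approximate tensor $\widehat{\mathcal{A}}$ with TT-ranks not higher than $\{r_k\}_{k=0}^d$, computed from $\mathcal{A}$ via the TT-URV algorithm for fixed TT-ranks in the right-to-left sweep, satisfies $$\|\mathcal{A}-\widehat{\mathcal{A}}\|_F\le\sqrt{\sum_{k=1}^{d-1}\varepsilon_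k^2}.$$
   Context: $\|\cdot\|_F$ is the Frobenius norm (square root of the sum of squares of all entries) of a matrix or tensor. All reshapings use the reverse lexicographic (column-major, MATLAB `reshape`) ordering: a multi-index $(i_1,\dots,i_p)$ with dimensions $(J_1,\dots,J_p)$ is merged into $i_1+\sum_{k=2}^p(i_k-1)\prod_{j=1}^{k-1}J_j$. The $k$th unfolding matrix $\mathbf{A}_k\in\mathbb{R}^{(I_1\cdots I_k)\times(I_{k+1}\cdots I_d)}$ of $\mathcal{A}$ has entries $\mathcal{A}_{i_1\cdots i_d}$, with row index merging $(i_1,\dots,i_k)$ and column index merging $(i_{k+1},\dots,i_d)$. TT format: a tensor is in TT format with cores $\mathcal{G}^{(k)}\in\mathbb{R}^{r_{k-1}\times I_k\times r_k}$, $k=1,\dots,d$ ($r_0=r_d=1$), if its entries are $\sum_{\alpha_0=1}^{r_0}\cdots\sum_{\alpha_d=1}^{r_d}\mathcal{G}^{(1)}_{\alpha_0i_1\alpha_1}\cdots\mathcal{G}^{(d)}_{\alpha_{d-1}i_d\alpha_d}$; the $r_k$ are its TT-ranks. URV decomposition of $\mathbf{A}\in\mathbb{R}^{m\times n}$ (with leading block size $r$): $\mathbf{A}=\mathbf{U}\begin{bmatrix}\mathbf{R}_{11}&\mathbf{R}_{12}\\ \mathbf{O}_{(m-r)\times r}&\mathbf{R}_{22}\end{bmatrix}\mathbf{V}^\top$, where $\mathbf{U}=[\mathbf{U}_1\ \mathbf{U}_2]\in\mathbb{R}^{m\times m}$ and $\mathbf{V}=[\mathbf{V}_1\ \mathbf{V}_2]\in\mathbb{R}^{n\times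 n}$ have orthonormal columns, $\mathbf{U}_1,\mathbf{V}_1$ have $r$ columns, $\mathbf{R}_{11}\in\mathbb{R}^{r\times r}$ and $\mathbf{R}_{22}\in\mathbb{R}^{(m-r)\times(n-r)}$ are upper triangular, $\mathbf{O}$ is a zero block, and $\mathbf{R}_{12}\in\mathbb{R}^{r\times(n-r)}$ (informally described as containing small entries). The truncated rank-$r$ approximation is $\mathbf{U}_1\mathbf{R}_{11}\mathbf{V}_1^\top$, with residual $\mathbf{E}=\mathbf{A}-\mathbf{U}_1\mathbf{R}_{11}\mathbf{V}_1^\top=(\mathbf{U}_1\mathbf{R}_{12}+\mathbf{U}_2\mathbf{R}_{22})\mathbf{V}_2^\top$ and error $\|\mathbf{E}\|_F$. TT-URV algorithm (right-to-left sweep, fixed TT-ranks $r_1,\dots,r_{d-1}$, $r_0=r_d=1$, taken such that every step makes sense). Start with $\mathbf{C}=\mathrm{reshape}(\mathcal{A},[I_1\cdots I_{d-1},\,I_d])$. For $k=d,d-1,\dots,2$: (i) set $\mathbf{C}:=\mathrm{reshape}(\mathbf{C},[I_1\cdots I_{k-1},\,I_kr_k])$; (ii) compute the truncated rank-$r_{k-1}$ approximation from a URV decomposition, $\mathbf{C}=\mathbf{U}_1\mathbf{R}_{11}\mathbf{V}_1^\top+\mathbf{E}$ with $\mathbf{R}_{11}\in\mathbb{R}^{r_{k-1}\times r_{k-1}}$ and $\mathbf{E}$ the residual; (iii) set $\mathcal{G}^{(k)}=\mathrm{reshape}(\mathbf{V}_1^\top,[r_{k-1},I_k,r_k])$; (iv)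 set $\mathbf{C}:=\mathbf{U}_1\mathbf{R}_{11}$. Finally $\mathcal{G}^{(1)}=\mathbf{C}$ (viewed as $1\times I_1\times r_1$). The output $\widehat{\mathcal{A}}$ is the tensor in TT format with cores $\mathcal{G}^{(1)},\dots,\mathcal{G}^{(d)}$.
   Formalization: URV decompositions need not have small residuals, so the bound can fail for some choices; it is proved for every TT-URV run whose truncation error at step k is at most ε_{k-1}, and such a run is shown to exist. *)

theory Defs
  imports Complex_Main "HOL-Library.FuncSet" "Jordan_Normal_Form.Matrix"
begin

text \<open>Modes and ranks carry the indices of the paper (modes \<open>1, \<dots>, d\<close>, ranks \<open>r 0, \<dots>, r d\<close>),
  while the entries along a mode are numbered from \<open>0\<close>: mode \<open>k\<close> has the index values
  \<open>0, \<dots>, I k - 1\<close>.\<close>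

subsection \<open>Tensors, column-major indexing, unfoldings\<close>

type_synonym tensor = "(nat \<Rightarrow> nat) \<Rightarrow> real"

definition multi_indices :: "nat \<Rightarrow> (nat \<Rightarrow> nat) \<Rightarrow> (nat \<Rightarrow> nat) set" where
  "multi_indices d I = PiE {1..d} (\<lambda>k. {..<I k})"

definition tensor_frob :: "nat \<Rightarrow> (nat \<Rightarrow> nat) \<Rightarrow> tensor \<Rightarrow> real" where
  "tensor_frob d I X = sqrt (\<Sum>i\<in>multi_indices d I. (X i)\<^sup>2)"

definition frob :: "real mat \<Rightarrow> real" where
  "frob A = sqrt (\<Sum>i<dim_row A. \<Sum>j<dim_col A. (A $$ (i, j))\<^sup>2)"

text \<open>Reverse lexicographic merging of the indices of the modes \<open>a, \<dots>, b\<close>, and the recovery of the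
  index of mode \<open>l\<close> from the merged number; \<open>unmerge_merge\<close> shows that it is the inverse.\<close>

definition merge :: "(nat \<Rightarrow> nat) \<Rightarrow> nat \<Rightarrow> nat \<Rightarrow> (nat \<Rightarrow> nat) \<Rightarrow> nat" where
  "merge I a b i = (\<Sum>k=a..b. i k * (\<Prod>j=a..<k. I j))"

definition unmerge :: "(nat \<Rightarrow> nat) \<Rightarrow> nat \<Rightarrow> nat \<Rightarrow> nat \<Rightarrow> nat" where
  "unmerge I a p l = (p div (\<Prod>j=a..<l. I j)) mod I l"

definition unfolding_mat :: "nat \<Rightarrow> (nat \<Rightarrow> nat) \<Rightarrow> tensor \<Rightarrow> nat \<Rightarrow> real mat" where
  "unfolding_mat d I X k = mat (\<Prod>l=1..k. I l) (\<Prod>l=k+1..d. I l)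
     (\<lambda>(p, q). X (\<lambda>l\<in>{1..d}. if l \<le> k then unmerge I 1 p l else unmerge I (k + 1) q l))"

lemma merge_Suc:
  assumes "a \<le> Suc b"
  shows "merge I a (Suc b) i = merge I a b i + i (Suc b) * (\<Prod>j=a..<Suc b. I j)"
  using assms by (simp add: merge_def)

lemma merge_less:
  assumes "\<And>k. k \<in> {a..<a+n} \<Longrightarrow> i k < I k" and "0 < a"
  shows "merge I a (a + n - 1) i < (\<Prod>j=a..<a+n. I j)"
  using assms
proof (induction n)
  case 0
  then show ?case by (simp add: merge_def)
next
  case (Suc n)
  obtain m where m: "a + n = Suc m" using Suc.prems(2) by (cases "a + n") auto
  have "merge I a m i < (\<Prod>j=a..<Suc m. I j)"
    using Suc.IH Suc.prems m by simp
  moreover have "Suc (i (Suc m)) \<le> I (Suc m)"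
    using Suc.prems(1)[of "a + n"] m by simp
  then have "Suc (i (Suc m)) * (\<Prod>j=a..<Suc m. I j) \<le> I (Suc m) * (\<Prod>j=a..<Suc m. I j)"
    by (rule mult_le_mono1)
  moreover have "a \<le> Suc m" using m by simp
  ultimately show ?case
    using m by (simp add: merge_Suc mult.commute del: prod.op_ivl_Suc)
      (simp add: mult.commute)
qed

lemma unmerge_merge:
  assumes "\<And>k. k \<in> {a..b} \<Longrightarrow> i k < I k" and "0 < a" and "l \<in> {a..b}"
  shows "unmerge I a (merge I a b i) l = i l"
proof -
  define P where "P k = (\<Prod>j=a..<k. I j)" for k
  have low: "merge I a (l - 1) i < P l"
    using merge_less[of a "l - a" i I] assms by (auto simp: P_def)
  have dvd: "P (Suc l) dvd P k" if "k > l" for k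
    unfolding P_def using that by (intro prod_dvd_prod_subset) auto
  have split: "{a..b} = {a..l-1} \<union> ({l} \<union> {Suc l..b})"
    using assms by auto
  have "merge I a b i = merge I a (l - 1) i + (i l * P l + (\<Sum>k=Suc l..b. i k * P k))"
    unfolding merge_def P_def[symmetric] split
    using assms by (subst sum.union_disjoint; force)+
  moreover have "P (Suc l) dvd (\<Sum>k=Suc l..b. i k * P k)"
    by (intro dvd_sum) (use dvd in auto)
  then obtain c where "(\<Sum>k=Suc l..b. i k * P k) = P (Suc l) * c" by blast
  moreover have "P (Suc l) = P l * I l"
    using assms by (simp add: P_def)
  ultimately have "merge I a b i = merge I a (l - 1) i + P l * (i l + I l * c)"
    by (simp add: algebra_simps)
  then have "merge I a b i div P l = i l + I l * c"
    using low by simp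
  then show ?thesis
    using assms by (simp add: unmerge_def P_def)
qed

lemma unfolding_mat_entry:
  assumes "i \<in> multi_indices d I" and "k \<le> d"
  shows "unfolding_mat d I X k $$ (merge I 1 k i, merge I (k + 1) d i) = X i"
proof -
  have less: "i l < I l" if "l \<in> {1..d}" for l
    using assms that by (auto simp: multi_indices_def)
  have "merge I 1 k i < (\<Prod>l=1..k. I l)"
    using merge_less[of 1 k i I] less assms by (auto simp: atLeastLessThanSuc_atLeastAtMost)
  moreover have "merge I (k + 1) d i < (\<Prod>l=k+1..d. I l)"
    using merge_less[of "k + 1" "d - k" i I] less assms
    by (auto simp: atLeastLessThanSuc_atLeastAtMost)
  moreover have "(\<lambda>l\<in>{1..d}. if l \<le> k then unmerge I 1 (merge I 1 k i) l
      else unmerge I (k + 1) (merge I (k + 1) d i) l) = i"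
  proof (rule extensionalityI[of _ "{1..d}"])
    show "i \<in> extensional {1..d}"
      using assms by (auto simp: multi_indices_def PiE_def)
    show "(\<lambda>l\<in>{1..d}. if l \<le> k then unmerge I 1 (merge I 1 k i) l
      else unmerge I (k + 1) (merge I (k + 1) d i) l) l = i l" if "l \<in> {1..d}" for l
      using that assms less by (auto intro!: unmerge_merge)
  qed auto
  ultimately show ?thesis by (simp add: unfolding_mat_def del: One_nat_def)
qed

text \<open>Column-major reshaping of a matrix: entry number \<open>n\<close> of \<open>M\<close> sits in row \<open>n mod dim_row M\<close>
  and column \<open>n div dim_row M\<close>.\<close>

definition flat :: "real mat \<Rightarrow> nat \<Rightarrow> real" where
  "flat M n = M $$ (n mod dim_row M, n div dim_row M)"

definition reshape_mat :: "real mat \<Rightarrow> nat \<Rightarrow> nat \<Rightarrow> real mat" where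
  "reshape_mat M m n = mat m n (\<lambda>(p, q). flat M (p + q * m))"

text \<open>The third dimension plays no role in the column-major formula; it is kept so that the
  notation matches \<open>reshape(M, [a, b, c])\<close>.\<close>

definition reshape3 :: "real mat \<Rightarrow> nat \<Rightarrow> nat \<Rightarrow> nat \<Rightarrow> (nat \<Rightarrow> nat \<Rightarrow> nat \<Rightarrow> real)" where
  "reshape3 M a b c = (\<lambda>\<alpha> i \<beta>. flat M (\<alpha> + i * a + \<beta> * (a * b)))"

subsection \<open>TT format\<close>

text \<open>Core \<open>k\<close> is \<open>G k\<close>, of size \<open>r (k - 1) \<times> I k \<times> r k\<close>.\<close>

definition tt_tensor :: "nat \<Rightarrow> (nat \<Rightarrow> nat) \<Rightarrow> (nat \<Rightarrow> nat \<Rightarrow> nat \<Rightarrow> nat \<Rightarrow> real) \<Rightarrow> tensor" where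
  "tt_tensor d r G = (\<lambda>i. \<Sum>\<alpha>\<in>PiE {0..d} (\<lambda>k. {..<r k}).
     \<Prod>k=1..d. G k (\<alpha> (k - 1)) (i k) (\<alpha> k))"

subsection \<open>URV decomposition\<close>

record urv =
  U1 :: "real mat"
  U2 :: "real mat"
  R11 :: "real mat"
  R12 :: "real mat"
  R22 :: "real mat"
  V1 :: "real mat"
  V2 :: "real mat"

definition append_cols :: "real mat \<Rightarrow> real mat \<Rightarrow> real mat" where
  "append_cols A B = four_block_mat A B (0\<^sub>m 0 (dim_col A)) (0\<^sub>m 0 (dim_col B))"

text \<open>The predicate \<open>upper_triangular\<close> of the matrix library also refers to entries outside of a
  matrix with more rows than columns, so it cannot be used for the rectangular block \<open>R22\<close>.\<close>

definition upper_tri :: "real mat \<Rightarrow> bool" where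
  "upper_tri A \<longleftrightarrow> (\<forall>i<dim_row A. \<forall>j<dim_col A. j < i \<longrightarrow> A $$ (i, j) = 0)"

definition is_urv :: "real mat \<Rightarrow> nat \<Rightarrow> urv \<Rightarrow> bool" where
  "is_urv A r D \<longleftrightarrow> (let m = dim_row A; n = dim_col A;
       U = append_cols (U1 D) (U2 D); V = append_cols (V1 D) (V2 D) in
     r \<le> m \<and> r \<le> n \<and>
     U1 D \<in> carrier_mat m r \<and> U2 D \<in> carrier_mat m (m - r) \<and>
     V1 D \<in> carrier_mat n r \<and> V2 D \<in> carrier_mat n (n - r) \<and>
     R11 D \<in> carrier_mat r r \<and> R12 D \<in> carrier_mat r (n - r) \<and>
     R22 D \<in> carrier_mat (m - r) (n - r) \<and>
     transpose_mat U * U = 1\<^sub>m m \<and> transpose_mat V * V = 1\<^sub>m n \<and>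
     upper_tri (R11 D) \<and> upper_tri (R22 D) \<and>
     A = U * four_block_mat (R11 D) (R12 D) (0\<^sub>m (m - r) r) (R22 D) * transpose_mat V)"

definition urv_residual :: "urv \<Rightarrow> real mat" where
  "urv_residual D = (U1 D * R12 D + U2 D * R22 D) * transpose_mat (V2 D)"

lemma urv_truncation_residual:
  assumes "is_urv A r D"
  shows "A = U1 D * R11 D * transpose_mat (V1 D) + urv_residual D"
    and "urv_residual D = A - U1 D * R11 D * transpose_mat (V1 D)"
proof -
  define m n where "m = dim_row A" and "n = dim_col A"
  note urv = assms[unfolded is_urv_def Let_def, folded m_def n_def]
  have c: "U1 D \<in> carrier_mat m r" "U2 D \<in> carrier_mat m (m - r)"
     "V1 D \<in> carrier_mat n r" "V2 D \<in> carrier_mat n (n - r)"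
     "R11 D \<in> carrier_mat r r" "R12 D \<in> carrier_mat r (n - r)"
     "R22 D \<in> carrier_mat (m - r) (n - r)"
    using urv by auto
  have d: "dim_col (U1 D) = r" "dim_col (U2 D) = m - r"
    "dim_col (V1 D) = r" "dim_col (V2 D) = n - r"
    using c by auto
  let ?B = "U1 D * R12 D + U2 D * R22 D"
  let ?L = "U1 D * R11 D * transpose_mat (V1 D)"
  have B: "?B \<in> carrier_mat m (n - r)" and UR: "U1 D * R11 D \<in> carrier_mat m r"
    using c by auto
  have UO: "U1 D * R11 D + U2 D * 0\<^sub>m (m - r) r = U1 D * R11 D"
    using c UR by simp
  have "append_cols (U1 D) (U2 D) * four_block_mat (R11 D) (R12 D) (0\<^sub>m (m - r) r) (R22 D)
      = four_block_mat (U1 D * R11 D) ?B (0\<^sub>m 0 r) (0\<^sub>m 0 (n - r))"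
    unfolding append_cols_def d
    by (subst mult_four_block_mat[of _ m r _ "m - r" _ 0 _ _ r _ "n - r"])
      (use c UO in auto)
  moreover have "transpose_mat (append_cols (V1 D) (V2 D))
      = four_block_mat (transpose_mat (V1 D)) (0\<^sub>m r 0) (transpose_mat (V2 D)) (0\<^sub>m (n - r) 0)"
    unfolding append_cols_def d
    by (subst transpose_four_block_mat[of _ n r _ "n - r" _ 0]) (use c in auto)
  ultimately have "A = four_block_mat (U1 D * R11 D) ?B (0\<^sub>m 0 r) (0\<^sub>m 0 (n - r))
      * four_block_mat (transpose_mat (V1 D)) (0\<^sub>m r 0) (transpose_mat (V2 D)) (0\<^sub>m (n - r) 0)"
    using urv by metis
  also have "\<dots> = four_block_mat (?L + ?B * transpose_mat (V2 D))
      (U1 D * R11 D * 0\<^sub>m r 0 + ?B * 0\<^sub>m (n - r) 0)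
      (0\<^sub>m 0 r * transpose_mat (V1 D) + 0\<^sub>m 0 (n - r) * transpose_mat (V2 D))
      (0\<^sub>m 0 r * 0\<^sub>m r 0 + 0\<^sub>m 0 (n - r) * 0\<^sub>m (n - r) 0)"
    by (rule mult_four_block_mat[of _ m r _ "n - r" _ 0 _ _ n _ 0]) (use c B UR in auto)
  also have "\<dots> = ?L + ?B * transpose_mat (V2 D)"
    by (rule eq_matI) (use c in \<open>auto simp: four_block_mat_def Let_def\<close>)
  finally show 1: "A = ?L + urv_residual D" by (simp add: urv_residual_def)
  have "?L \<in> carrier_mat m n" "urv_residual D \<in> carrier_mat m n"
    using c B by (auto simp: urv_residual_def)
  moreover have "E = (L + E) - L" if "L \<in> carrier_mat m n" "E \<in> carrier_mat m n" for L E :: "real mat"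
    using that by (intro eq_matI) auto
  ultimately show "urv_residual D = A - ?L"
    using 1 by metis
qed

subsection \<open>TT-URV, right-to-left sweep\<close>

text \<open>A run of the algorithm. URV decompositions are not unique, so the algorithm is a relation:
  \<open>C k\<close> is the matrix with which step \<open>k\<close> starts (\<open>k = d, \<dots>, 2\<close>), \<open>F k\<close> is the decomposition
  computed in step \<open>k\<close>, and \<open>G k\<close> are the resulting cores. The initial matrix
  \<open>reshape(X, [I 1 \<cdots> I (d - 1), I d])\<close> is the unfolding \<open>d - 1\<close>.\<close>

definition tt_urv_run ::
  "nat \<Rightarrow> (nat \<Rightarrow> nat) \<Rightarrow> (nat \<Rightarrow> nat) \<Rightarrow> tensor \<Rightarrow>
   (nat \<Rightarrow> real mat) \<Rightarrow> (nat \<Rightarrow> urv) \<Rightarrow> (nat \<Rightarrow> nat \<Rightarrow> nat \<Rightarrow> nat \<Rightarrow> real) \<Rightarrow> bool" where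
  "tt_urv_run d I r X C F G \<longleftrightarrow>
     C d = unfolding_mat d I X (d - 1) \<and>
     (\<forall>k\<in>{2..d}.
        is_urv (reshape_mat (C k) (\<Prod>l=1..k-1. I l) (I k * r k)) (r (k - 1)) (F k) \<and>
        G k = reshape3 (transpose_mat (V1 (F k))) (r (k - 1)) (I k) (r k) \<and>
        C (k - 1) = U1 (F k) * R11 (F k)) \<and>
     G 1 = reshape3 (C 1) 1 (I 1) (r 1)"

end

theory Submission
  imports Defs "Jordan_Normal_Form.Determinant"
begin

text \<open>
  The error of a run obeys an identity (\<open>tt_urv_error\<close>): the squared distance between the tensor and
  the output is the sum of the squared residual norms of the decompositions made during the sweep.
  In a URV decomposition of a matrix \<open>B\<close> the lower left block is zero and the right factor
  \<open>[V\<^sub>1 V\<^sub>2]\<close> is orthogonal, so the residual \<open>E\<close> satisfies \<open>E V\<^sub>1 = 0\<close>. Later steps only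
  change the factor \<open>U\<^sub>1 R\<^sub>1\<^sub>1\<close> of the approximation \<open>U\<^sub>1 R\<^sub>1\<^sub>1 V\<^sub>1\<^sup>T\<close>, hence their
  contribution to the error is orthogonal to \<open>E\<close>, and multiplication by \<open>V\<^sub>1\<^sup>T\<close> preserves its
  norm (\<open>urv_error_split\<close>). Reshaping preserves the norm as well, so the squares add up from step
  to step (\<open>tt_urv_prefix_error\<close>).

  What remains is that the sweep can keep the residual of step \<open>k\<close> below that of the given
  decomposition of the unfolding \<open>A = A\<^sub>k\<^sub>-\<^sub>1\<close> (\<open>tt_urv_run_exists\<close>). The matrix met in step \<open>k\<close> is
  \<open>A K\<close> for some \<open>K\<close> with orthonormal columns: the sweep multiplies from the right by factors
  with orthonormal columns, and when a reshaping moves a mode from the rows to the columns, such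
  a factor turns into its Kronecker product with an identity (\<open>reshape_mult_eq_mult_kron_id\<close>),
  whose columns are again orthonormal. If
  \<open>A = U\<^sub>1 R\<^sub>1\<^sub>1 V\<^sub>1\<^sup>T + E\<close>, then \<open>U\<^sub>1 R\<^sub>1\<^sub>1 (K\<^sup>T V\<^sub>1)\<^sup>T\<close> approximates \<open>A K\<close> with the error
  \<open>E K\<close>, which is at most as large as \<open>E\<close>. A QR decomposition of \<open>K\<^sup>T V\<^sub>1\<close> gives an orthogonal
  matrix whose leading columns span a space containing the columns of \<open>K\<^sup>T V\<^sub>1\<close>, and a QR
  decomposition of \<open>A K\<close> times this matrix completes it to a URV decomposition of \<open>A K\<close>
  (\<open>urv_prescribed_range\<close>). Its truncation is the best approximation of \<open>A K\<close> whose rows lie in that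
  space (\<open>urv_residual_le\<close>), hence at least as good as the one above (\<open>urv_of_compression\<close>).
\<close>

section \<open>Pythagoras for the Frobenius norm\<close>

lemma mult_mat_entry:
  assumes "A \<in> carrier_mat m n" "B \<in> carrier_mat n q" "i < m" "j < q"
  shows "(A * B) $$ (i, j) = (\<Sum>k<n. A $$ (i, k) * B $$ (k, j))"
  using assms by (auto simp: scalar_prod_def lessThan_atLeast0 intro!: sum.cong)

lemma frob_sq: "(frob A)\<^sup>2 = (\<Sum>i<dim_row A. \<Sum>j<dim_col A. (A $$ (i, j))\<^sup>2)"
  unfolding frob_def by (intro real_sqrt_pow2 sum_nonneg) auto

lemma frob_nonneg: "0 \<le> frob A"
  unfolding frob_def by (intro real_sqrt_ge_zero sum_nonneg) auto

lemma frob_sq_eq_gram: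
  assumes A: "A \<in> carrier_mat m n"
  shows "(frob A)\<^sup>2 = (\<Sum>i<m. (A * transpose_mat A) $$ (i, i))"
proof -
  have "(A * transpose_mat A) $$ (i, i) = (\<Sum>j<n. (A $$ (i, j))\<^sup>2)" if "i < m" for i
    using that A by (subst mult_mat_entry[of _ m n _ m]) (auto simp: power2_eq_square)
  then show ?thesis using A by (simp add: frob_sq)
qed

lemma frob_sq_add_orthogonal:
  assumes A: "A \<in> carrier_mat m n" and B: "B \<in> carrier_mat m n"
    and orth: "A * transpose_mat B = 0\<^sub>m m m"
  shows "(frob (A + B))\<^sup>2 = (frob A)\<^sup>2 + (frob B)\<^sup>2"
proof -
  have "(\<Sum>j<n. A $$ (i, j) * B $$ (i, j)) = 0" if "i < m" for i
  proof -
    have "(\<Sum>j<n. A $$ (i, j) * B $$ (i, j)) = (A * transpose_mat B) $$ (i, i)"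
      using that A B by (subst mult_mat_entry[of _ m n _ m]) auto
    then show ?thesis using that by (simp add: orth)
  qed
  then have "(\<Sum>j<n. ((A + B) $$ (i, j))\<^sup>2)
      = (\<Sum>j<n. (A $$ (i, j))\<^sup>2) + (\<Sum>j<n. (B $$ (i, j))\<^sup>2)" if "i < m" for i
    using that A B
    by (simp add: power2_sum sum.distrib mult.assoc flip: sum_distrib_left)
  then show ?thesis using A B by (simp add: frob_sq sum.distrib)
qed

text \<open>\<open>E V = 0\<close> makes each row of \<open>E\<close> orthogonal to the rows of \<open>Y V\<^sup>T\<close>, and the Gram matrices of
  \<open>Y V\<^sup>T\<close> and \<open>Y\<close> agree because \<open>V\<^sup>T V = 1\<close>.\<close>

lemma frob_sq_isometry_split:
  assumes E: "E \<in> carrier_mat m n" and Y: "Y \<in> carrier_mat m r" and V: "V \<in> carrier_mat n r"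
    and iso: "transpose_mat V * V = 1\<^sub>m r" and EV: "E * V = 0\<^sub>m m r"
  shows "(frob (E + Y * transpose_mat V))\<^sup>2 = (frob E)\<^sup>2 + (frob Y)\<^sup>2"
proof -
  let ?YV = "Y * transpose_mat V"
  have YV: "?YV \<in> carrier_mat m n" and T: "transpose_mat ?YV = V * transpose_mat Y"
    using Y V by (auto simp: transpose_mult[of _ m r _ n])
  have "E * transpose_mat ?YV = E * V * transpose_mat Y"
    unfolding T using E V Y by (simp add: assoc_mult_mat[of _ m n _ r _ m])
  also have "\<dots> = 0\<^sub>m m m" using Y by (simp add: EV)
  finally have "(frob (E + ?YV))\<^sup>2 = (frob E)\<^sup>2 + (frob ?YV)\<^sup>2"
    by (rule frob_sq_add_orthogonal[OF E YV])
  moreover have "?YV * transpose_mat ?YV = Y * (transpose_mat V * V * transpose_mat Y)"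
    unfolding T using Y V
    by (simp add: assoc_mult_mat[of _ m r _ n _ m] assoc_mult_mat[of _ r n _ r _ m])
  then have "?YV * transpose_mat ?YV = Y * transpose_mat Y"
    using Y by (simp add: iso)
  then have "(frob ?YV)\<^sup>2 = (frob Y)\<^sup>2"
    using frob_sq_eq_gram[OF YV] frob_sq_eq_gram[OF Y] by simp
  ultimately show ?thesis by simp
qed

text \<open>\<open>A W\<close> is what remains of \<open>A\<close> after its rows are projected to the column space of \<open>W\<close>.\<close>

lemma frob_mult_isometry_le:
  assumes A: "A \<in> carrier_mat m n" and W: "W \<in> carrier_mat n r"
    and iso: "transpose_mat W * W = 1\<^sub>m r"
  shows "frob (A * W) \<le> frob A"
proof -
  let ?P = "A * W * transpose_mat W"
  have AW: "A * W \<in> carrier_mat m r" and P: "?P \<in> carrier_mat m n" using A W by auto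
  have PW: "?P * W = A * W * (transpose_mat W * W)"
    using AW W by (simp add: assoc_mult_mat[of _ m r _ n _ r])
  have "(A - ?P) * W = A * W - ?P * W"
    using A P W by (simp add: minus_mult_distrib_mat[of _ m n])
  also have "\<dots> = 0\<^sub>m m r"
    unfolding PW iso right_mult_one_mat[OF AW] by (rule minus_r_inv_mat[OF AW])
  finally have "(A - ?P) * W = 0\<^sub>m m r" .
  then have "(frob (A - ?P + ?P))\<^sup>2 = (frob (A - ?P))\<^sup>2 + (frob (A * W))\<^sup>2"
    using A P by (intro frob_sq_isometry_split[of _ m n _ r]) (use AW W iso in auto)
  moreover have "A - ?P + ?P = A" using A P by (intro eq_matI) auto
  ultimately have "(frob (A * W))\<^sup>2 \<le> (frob A)\<^sup>2" by simp
  then show ?thesis using frob_nonneg power2_le_imp_le by blast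
qed

section \<open>Column-major reshaping\<close>

lemma pair_number_less:
  fixes p q m n :: nat
  assumes "p < m" "q < n"
  shows "p + q * m < m * n"
proof -
  have "p + q * m < Suc q * m" using assms by simp
  also have "\<dots> \<le> n * m" using assms by (intro mult_le_mono1) simp
  finally show ?thesis by (simp add: mult.commute)
qed

lemma sum_pair_number:
  fixes f :: "nat \<Rightarrow> 'a::comm_monoid_add"
  shows "(\<Sum>x<m * n. f x) = (\<Sum>q<n. \<Sum>p<m. f (p + q * m))"
proof -
  have "(\<Sum>x<m * n. f x) = (\<Sum>q<n. sum f {q * m..<q * m + m})"
    by (simp add: sum.nat_group mult.commute)
  also have "\<dots> = (\<Sum>q<n. \<Sum>p<m. f (p + q * m))"
  proof (rule sum.cong[OF refl])
    show "sum f {q * m..<q * m + m} = (\<Sum>p<m. f (p + q * m))" for q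
      using sum.shift_bounds_nat_ivl[of f 0 "q * m" m] by (simp add: lessThan_atLeast0 add.commute)
  qed
  finally show ?thesis .
qed

lemma reshape_mat_carrier [simp]: "reshape_mat M m n \<in> carrier_mat m n"
  by (simp add: reshape_mat_def)

lemma reshape_mat_dim [simp]:
  "dim_row (reshape_mat M m n) = m" "dim_col (reshape_mat M m n) = n"
  by (simp_all add: reshape_mat_def)

lemma reshape_mat_entry:
  "p < m \<Longrightarrow> q < n \<Longrightarrow> reshape_mat M m n $$ (p, q) = flat M (p + q * m)"
  by (simp add: reshape_mat_def)

lemma flat_pair:
  "M \<in> carrier_mat m n \<Longrightarrow> p < m \<Longrightarrow> flat M (p + q * m) = M $$ (p, q)"
  by (auto simp: flat_def)

lemma flat_reshape_mat:
  assumes "x < m * n"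
  shows "flat (reshape_mat M m n) x = flat M x"
proof -
  have "0 < m" using assms by (cases m) auto
  moreover have "x div m < n" using assms by (simp add: less_mult_imp_div_less mult.commute)
  ultimately show ?thesis by (simp add: flat_def[of "reshape_mat M m n"] reshape_mat_entry)
qed

lemma reshape_mat_cong:
  assumes "\<And>x. x < m * n \<Longrightarrow> flat A x = flat B x"
  shows "reshape_mat A m n = reshape_mat B m n"
  by (rule eq_matI) (use assms pair_number_less in \<open>auto simp: reshape_mat_entry\<close>)

lemma reshape_reshape_mat:
  assumes "p * q = m * n"
  shows "reshape_mat (reshape_mat M m n) p q = reshape_mat M p q"
  by (rule reshape_mat_cong) (use assms in \<open>auto simp: flat_reshape_mat\<close>)

lemma reshape_mat_id:
  assumes "M \<in> carrier_mat m n"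
  shows "reshape_mat M m n = M"
  by (rule eq_matI) (use assms in \<open>auto simp: reshape_mat_entry flat_pair\<close>)

lemma frob_sq_flat:
  assumes "M \<in> carrier_mat m n"
  shows "(frob M)\<^sup>2 = (\<Sum>x<m * n. (flat M x)\<^sup>2)"
proof -
  have "(\<Sum>x<m * n. (flat M x)\<^sup>2) = (\<Sum>q<n. \<Sum>p<m. (M $$ (p, q))\<^sup>2)"
    unfolding sum_pair_number using assms by (intro sum.cong) (auto simp: flat_pair)
  also have "\<dots> = (\<Sum>p<m. \<Sum>q<n. (M $$ (p, q))\<^sup>2)" by (rule sum.swap)
  finally show ?thesis using assms by (simp add: frob_sq)
qed

lemma frob_sq_diff_reshape_mat:
  assumes "A \<in> carrier_mat m n" "B \<in> carrier_mat m n" "m * n = p * q"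
  shows "(frob (reshape_mat A p q - reshape_mat B p q))\<^sup>2 = (frob (A - B))\<^sup>2"
proof -
  have flat_minus: "flat (M - N) x = flat M x - flat N x"
    if "M \<in> carrier_mat a b" "N \<in> carrier_mat a b" "x < a * b" for M N a b x
  proof -
    have "0 < a" using that by (cases a) auto
    moreover have "x div a < b" using that by (simp add: less_mult_imp_div_less mult.commute)
    ultimately show ?thesis using that by (auto simp: flat_def)
  qed
  have "(frob (reshape_mat A p q - reshape_mat B p q))\<^sup>2
      = (\<Sum>x<p * q. (flat (reshape_mat A p q - reshape_mat B p q) x)\<^sup>2)"
    by (rule frob_sq_flat) (simp add: minus_carrier_mat)
  also have "\<dots> = (\<Sum>x<m * n. (flat (A - B) x)\<^sup>2)"
    using assms(3)
    by (intro sum.cong) (auto simp: flat_minus[of _ p q] flat_minus[OF assms(1,2)] flat_reshape_mat)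
  also have "\<dots> = (frob (A - B))\<^sup>2"
    by (rule frob_sq_flat[symmetric]) (use assms in \<open>simp add: minus_carrier_mat\<close>)
  finally show ?thesis .
qed

section \<open>Right multiplication and reshaping\<close>

text \<open>The Kronecker product of \<open>W\<close> with the identity of size \<open>b\<close>, in the ordering in which the index
  of the identity runs fastest. This is the ordering that column-major reshaping produces.\<close>

definition kron_id :: "nat \<Rightarrow> real mat \<Rightarrow> real mat" where
  "kron_id b W = mat (b * dim_row W) (b * dim_col W)
     (\<lambda>(x, y). if x mod b = y mod b then W $$ (x div b, y div b) else 0)"

lemma kron_id_carrier: "W \<in> carrier_mat m n \<Longrightarrow> kron_id b W \<in> carrier_mat (b * m) (b * n)"
  by (simp add: kron_id_def)

lemma kron_id_entry:
  assumes "W \<in> carrier_mat m n" "i < b" "j < b" "p < m" "q < n"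
  shows "kron_id b W $$ (i + p * b, j + q * b) = (if i = j then W $$ (p, q) else 0)"
  using assms pair_number_less[of i b p m] pair_number_less[of j b q n]
  by (simp add: kron_id_def)

text \<open>Reshaping moves the last row mode, of size \<open>b\<close>, to the front of the columns. The matrix \<open>W\<close> acts
  on the old column index only, so it leaves the moved index alone.\<close>

lemma reshape_mult_eq_mult_kron_id:
  assumes A: "A \<in> carrier_mat (m * b) n" and W: "W \<in> carrier_mat n c"
  shows "reshape_mat (A * W) m (b * c) = reshape_mat A m (b * n) * kron_id b W"
proof (rule eq_matI)
  note K = kron_id_carrier[OF W, of b]
  show "dim_row (reshape_mat (A * W) m (b * c)) = dim_row (reshape_mat A m (b * n) * kron_id b W)"
    "dim_col (reshape_mat (A * W) m (b * c)) = dim_col (reshape_mat A m (b * n) * kron_id b W)"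
    using K by auto
  fix p y
  assume "p < dim_row (reshape_mat A m (b * n) * kron_id b W)"
    and "y < dim_col (reshape_mat A m (b * n) * kron_id b W)"
  then have p: "p < m" and y: "y < b * c" using K by auto
  define j s where "j = y mod b" and "s = y div b"
  have "0 < b" using y by (cases b) auto
  then have j: "j < b" and s: "s < c" and yjs: "y = j + s * b"
    using y by (auto simp: j_def s_def less_mult_imp_div_less mult.commute)
  have pj: "p + j * m < m * b" by (rule pair_number_less[OF p j])
  have num: "p + (j + q * b) * m = (p + j * m) + q * (m * b)" for q
    by (simp add: algebra_simps)
  have "(reshape_mat A m (b * n) * kron_id b W) $$ (p, y)
      = (\<Sum>x<b * n. reshape_mat A m (b * n) $$ (p, x) * kron_id b W $$ (x, y))"
    by (rule mult_mat_entry[OF _ K p y]) simp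
  also have "\<dots> = (\<Sum>q<n. \<Sum>i<b. reshape_mat A m (b * n) $$ (p, i + q * b)
      * (if i = j then W $$ (q, s) else 0))"
    unfolding sum_pair_number using W j s by (intro sum.cong) (auto simp: yjs kron_id_entry)
  also have "\<dots> = (\<Sum>q<n. reshape_mat A m (b * n) $$ (p, j + q * b) * W $$ (q, s))"
    using j by (simp add: if_distrib cong: if_cong)
  also have "\<dots> = (\<Sum>q<n. A $$ (p + j * m, q) * W $$ (q, s))"
    using p j pair_number_less[of j b _ n] A pj
    by (intro sum.cong) (auto simp: reshape_mat_entry num flat_pair)
  also have "\<dots> = (A * W) $$ (p + j * m, s)"
    by (rule mult_mat_entry[OF A W pj s, symmetric])
  also have "\<dots> = flat (A * W) (p + y * m)"
    unfolding yjs num by (rule flat_pair[symmetric, of _ _ c]) (use A W pj in auto)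
  also have "\<dots> = reshape_mat (A * W) m (b * c) $$ (p, y)"
    using p y by (simp add: reshape_mat_entry)
  finally show "reshape_mat (A * W) m (b * c) $$ (p, y)
      = (reshape_mat A m (b * n) * kron_id b W) $$ (p, y)" by simp
qed

lemma kron_id_isometry:
  assumes W: "W \<in> carrier_mat n c" and iso: "transpose_mat W * W = 1\<^sub>m c"
  shows "transpose_mat (kron_id b W) * kron_id b W = 1\<^sub>m (b * c)"
proof (rule eq_matI)
  note K = kron_id_carrier[OF W, of b]
  fix x y assume "x < dim_row (1\<^sub>m (b * c) :: real mat)" "y < dim_col (1\<^sub>m (b * c) :: real mat)"
  then have x: "x < b * c" and y: "y < b * c" by auto
  define i s j t where "i = x mod b" and "s = x div b" and "j = y mod b" and "t = y div b"
  have "0 < b" using y by (cases b) auto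
  then have i: "i < b" and s: "s < c" and xis: "x = i + s * b"
    and j: "j < b" and t: "t < c" and yjt: "y = j + t * b"
    using x y by (auto simp: i_def s_def j_def t_def less_mult_imp_div_less mult.commute)
  have "(transpose_mat (kron_id b W) * kron_id b W) $$ (x, y)
      = (\<Sum>z<b * n. kron_id b W $$ (z, x) * kron_id b W $$ (z, y))"
    using K x y by (subst mult_mat_entry[of _ "b * c" "b * n" _ "b * c"]) auto
  also have "\<dots> = (\<Sum>q<n. \<Sum>l<b. (if l = i then W $$ (q, s) else 0) * (if l = j then W $$ (q, t) else 0))"
    unfolding sum_pair_number xis yjt using W i j s t
    by (intro sum.cong refl) (auto simp: kron_id_entry)
  also have "\<dots> = (if i = j then \<Sum>q<n. W $$ (q, s) * W $$ (q, t) else 0)"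
  proof (cases "i = j")
    case True
    have "(if l = j then u else 0) * (if l = j then v else 0) = (if l = j then u * v else 0)"
      for l and u v :: real by simp
    then show ?thesis using True j by simp
  next
    case False
    then show ?thesis by (auto intro!: sum.neutral)
  qed
  also have "(\<Sum>q<n. W $$ (q, s) * W $$ (q, t)) = (transpose_mat W * W) $$ (s, t)"
    using W s t by (subst mult_mat_entry[of _ c n _ c]) auto
  also have "(if i = j then (transpose_mat W * W) $$ (s, t) else 0) = (if x = y then 1 else 0)"
  proof -
    have "x = y \<longleftrightarrow> i = j \<and> s = t"
      unfolding i_def j_def s_def t_def by (metis div_mult_mod_eq)
    then show ?thesis using s t by (simp add: iso)
  qed
  finally show "(transpose_mat (kron_id b W) * kron_id b W) $$ (x, y) = 1\<^sub>m (b * c) $$ (x, y)"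
    using x y by simp
qed (use kron_id_carrier[OF W, of b] in auto)

section \<open>Unfoldings of one tensor are reshapings of each other\<close>

lemma merge_split:
  assumes "k \<le> d"
  shows "merge I 1 d i = merge I 1 k i + merge I (k + 1) d i * (\<Prod>l=1..k. I l)"
proof -
  have "(\<Prod>j=1..<l. I j) = (\<Prod>j=k+1..<l. I j) * (\<Prod>j=1..k. I j)" if "k + 1 \<le> l" for l
  proof -
    have "{1..<l} = {k+1..<l} \<union> {1..k}" using that by auto
    also have "prod I \<dots> = (\<Prod>j=k+1..<l. I j) * (\<Prod>j=1..k. I j)"
      by (rule prod.union_disjoint) auto
    finally show ?thesis .
  qed
  then have "(\<Sum>l=k+1..d. i l * (\<Prod>j=1..<l. I j))
      = merge I (k + 1) d i * (\<Prod>l=1..k. I l)"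
    by (simp add: merge_def sum_distrib_right mult.assoc)
  moreover have "{1..d} = {1..k} \<union> {k+1..d}" using assms by auto
  ultimately show ?thesis by (simp add: merge_def sum.union_disjoint)
qed

text \<open>Injectivity comes from \<open>unmerge_merge\<close>, and both sides have the same number of elements.\<close>

lemma merge_bij:
  "bij_betw (merge I 1 d) (multi_indices d I) {..<\<Prod>l=1..d. I l}"
proof -
  have less: "i l < I l" if "i \<in> multi_indices d I" "l \<in> {1..d}" for i l
    using that by (auto simp: multi_indices_def)
  have inj: "inj_on (merge I 1 d) (multi_indices d I)"
  proof (rule inj_onI)
    fix i j assume ij: "i \<in> multi_indices d I" "j \<in> multi_indices d I"
      and eq: "merge I 1 d i = merge I 1 d j"
    show "i = j"
    proof (rule PiE_ext)
      show "i \<in> PiE {1..d} (\<lambda>k. {..<I k})" "j \<in> PiE {1..d} (\<lambda>k. {..<I k})"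
        using ij by (simp_all only: multi_indices_def)
      fix l assume l: "l \<in> {1..d}"
      have "unmerge I 1 (merge I 1 d i) l = i l"
        by (rule unmerge_merge[OF less[OF ij(1)] _ l]) simp_all
      moreover have "unmerge I 1 (merge I 1 d j) l = j l"
        by (rule unmerge_merge[OF less[OF ij(2)] _ l]) simp_all
      ultimately show "i l = j l" using eq by simp
    qed
  qed
  moreover have sub: "merge I 1 d ` multi_indices d I \<subseteq> {..<\<Prod>l=1..d. I l}"
  proof (rule image_subsetI)
    fix i assume i: "i \<in> multi_indices d I"
    have "merge I 1 (1 + d - 1) i < (\<Prod>l=1..<1 + d. I l)"
      by (rule merge_less) (use less[OF i] in auto)
    then show "merge I 1 d i \<in> {..<\<Prod>l=1..d. I l}"
      by (simp add: atLeastLessThanSuc_atLeastAtMost)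
  qed
  moreover have "card (merge I 1 d ` multi_indices d I) = card {..<\<Prod>l=1..d. I l}"
    unfolding card_image[OF inj] by (simp add: multi_indices_def card_PiE)
  ultimately show ?thesis by (simp add: bij_betw_def card_subset_eq)
qed

lemma unfolding_mat_carrier [simp]:
  "unfolding_mat d I X k \<in> carrier_mat (\<Prod>l=1..k. I l) (\<Prod>l=k+1..d. I l)"
  by (simp add: unfolding_mat_def)

text \<open>The column-major position of an entry in an unfolding is the merged number of its multi-index,
  whichever \<open>k\<close> is used to split the modes into rows and columns.\<close>

lemma flat_unfolding_mat:
  assumes i: "i \<in> multi_indices d I" and k: "k \<le> d"
  shows "flat (unfolding_mat d I X k) (merge I 1 d i) = X i"
proof -
  have "merge I 1 k i < (\<Prod>l=1..k. I l)"
    using merge_less[of 1 k i I] i k by (fastforce simp: multi_indices_def atLeastLessThanSuc_atLeastAtMost)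
  then show ?thesis
    unfolding merge_split[OF k]
    by (simp add: flat_pair[OF unfolding_mat_carrier] unfolding_mat_entry[OF i k] del: One_nat_def)
qed

lemma prod_split_modes:
  fixes I :: "nat \<Rightarrow> nat"
  assumes "k \<le> d"
  shows "(\<Prod>l=1..k. I l) * (\<Prod>l=k+1..d. I l) = (\<Prod>l=1..d. I l)"
proof -
  have "{1..d} = {1..k} \<union> {k+1..d}" using assms by auto
  then show ?thesis by (simp add: prod.union_disjoint)
qed

lemma unfolding_mat_eqI:
  assumes M: "M \<in> carrier_mat (\<Prod>l=1..k. I l) (\<Prod>l=k+1..d. I l)" and k: "k \<le> d"
    and entries: "\<And>i. i \<in> multi_indices d I \<Longrightarrow> flat M (merge I 1 d i) = X i"
  shows "M = unfolding_mat d I X k"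
proof -
  have "flat M x = flat (unfolding_mat d I X k) x"
    if "x < (\<Prod>l=1..k. I l) * (\<Prod>l=k+1..d. I l)" for x
  proof -
    have "x \<in> merge I 1 d ` multi_indices d I"
      using that bij_betw_imp_surj_on[OF merge_bij, of I d] prod_split_modes[OF k, of I] by auto
    then show ?thesis using k entries by (auto simp: flat_unfolding_mat simp del: One_nat_def)
  qed
  then show ?thesis
    using reshape_mat_cong reshape_mat_id[OF M] reshape_mat_id[OF unfolding_mat_carrier] by metis
qed

lemma reshape_unfolding_mat:
  assumes j: "j \<le> d" and k: "k \<le> d"
  shows "reshape_mat (unfolding_mat d I X k) (\<Prod>l=1..j. I l) (\<Prod>l=j+1..d. I l)
    = unfolding_mat d I X j"
proof (rule unfolding_mat_eqI[OF reshape_mat_carrier j])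
  fix i assume i: "i \<in> multi_indices d I"
  then have "merge I 1 d i < (\<Prod>l=1..j. I l) * (\<Prod>l=j+1..d. I l)"
    using bij_betwE[OF merge_bij[of I d]] prod_split_modes[OF j, of I] by auto
  then show "flat (reshape_mat (unfolding_mat d I X k) (\<Prod>l=1..j. I l) (\<Prod>l=j+1..d. I l)) (merge I 1 d i) = X i"
    by (simp only: flat_reshape_mat flat_unfolding_mat[OF i k])
qed

lemma tensor_frob_sq_unfolding:
  assumes "k \<le> d"
  shows "(tensor_frob d I X)\<^sup>2 = (frob (unfolding_mat d I X k))\<^sup>2"
proof -
  have "(tensor_frob d I X)\<^sup>2 = (\<Sum>i\<in>multi_indices d I. (flat (unfolding_mat d I X k) (merge I 1 d i))\<^sup>2)"
    using assms by (simp add: tensor_frob_def sum_nonneg flat_unfolding_mat del: One_nat_def)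
  also have "\<dots> = (\<Sum>x<\<Prod>l=1..d. I l. (flat (unfolding_mat d I X k) x)\<^sup>2)"
    by (rule sum.reindex_bij_betw[OF merge_bij])
  also have "\<dots> = (frob (unfolding_mat d I X k))\<^sup>2"
    using frob_sq_flat[OF unfolding_mat_carrier] prod_split_modes[OF assms] by metis
  finally show ?thesis .
qed

section \<open>QR and URV decompositions\<close>

text \<open>The reflection along \<open>u = v - \<parallel>v\<parallel> e\<^sub>0\<close> maps \<open>v\<close> to \<open>\<parallel>v\<parallel> e\<^sub>0\<close>.\<close>

lemma householder:
  fixes v :: "nat \<Rightarrow> real"
  obtains H where "H \<in> carrier_mat n n" "transpose_mat H * H = 1\<^sub>m n"
    "\<And>i. i < n \<Longrightarrow> i \<noteq> 0 \<Longrightarrow> (\<Sum>k<n. H $$ (i, k) * v k) = 0"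
proof -
  define s where "s = sqrt (\<Sum>k<n. (v k)\<^sup>2)"
  define u where "u k = v k - (if k = 0 then s else 0)" for k
  define S where "S = (\<Sum>k<n. (u k)\<^sup>2)"
  \<comment> \<open>If \<open>u = 0\<close>, then \<open>t = 2 / 0 = 0\<close> and \<open>H\<close> is the identity, as it should be.\<close>
  define t where "t = 2 / S"
  define H where "H = mat n n (\<lambda>(i, j). (if i = j then 1 else 0) - t * u i * u j)"
  have H: "H \<in> carrier_mat n n" by (simp add: H_def)
  have ss: "s\<^sup>2 = (\<Sum>k<n. (v k)\<^sup>2)" by (simp add: s_def sum_nonneg)
  have tt: "t * t * S = 2 * t" by (simp add: t_def)
  have orth: "transpose_mat H * H = 1\<^sub>m n"
  proof (rule eq_matI)
    fix i j assume "i < dim_row (1\<^sub>m n :: real mat)" "j < dim_col (1\<^sub>m n :: real mat)"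
    then have i: "i < n" and j: "j < n" by auto
    have "(transpose_mat H * H) $$ (i, j)
        = (\<Sum>k<n. ((if k = i then 1 else 0) - t * u k * u i) * ((if k = j then 1 else 0) - t * u k * u j))"
      using i j H by (subst mult_mat_entry[of _ n n _ n]) (auto simp: H_def)
    also have "\<dots> = (\<Sum>k<n. (if k = i then (if i = j then 1 else 0) - t * u i * u j else 0)
        - (if k = j then t * u j * u i else 0) + t * t * u i * u j * (u k)\<^sup>2)"
      by (intro sum.cong) (auto simp: algebra_simps power2_eq_square)
    also have "\<dots> = (if i = j then 1 else 0) - 2 * t * u i * u j + (t * t * S) * u i * u j"
      using i j by (simp add: sum.distrib sum_subtractf S_def sum_distrib_left sum_distrib_right mult_ac)
    also have "\<dots> = 1\<^sub>m n $$ (i, j)" using i j by (simp add: tt)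
    finally show "(transpose_mat H * H) $$ (i, j) = 1\<^sub>m n $$ (i, j)" .
  qed (use H in auto)
  have below: "(\<Sum>k<n. H $$ (i, k) * v k) = 0" if i: "i < n" "i \<noteq> 0" for i
  proof -
    have n: "0 < n" using i by simp
    have uv: "(\<Sum>k<n. u k * v k) = s\<^sup>2 - s * v 0"
    proof -
      have "(\<Sum>k<n. u k * v k) = (\<Sum>k<n. (v k)\<^sup>2 - (if k = 0 then s * v 0 else 0))"
        by (intro sum.cong) (auto simp: u_def algebra_simps power2_eq_square)
      then show ?thesis using n by (simp add: sum_subtractf ss)
    qed
    have "S = (\<Sum>k<n. (v k)\<^sup>2 + (if k = 0 then s\<^sup>2 - 2 * s * v 0 else 0))"
      unfolding S_def by (intro sum.cong) (auto simp: u_def algebra_simps power2_eq_square)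
    then have S2: "S = 2 * (\<Sum>k<n. u k * v k)"
      using n by (simp add: sum.distrib ss uv)
    have "(\<Sum>k<n. H $$ (i, k) * v k) = (\<Sum>k<n. (if k = i then v i else 0) - t * u i * (u k * v k))"
      using i by (intro sum.cong) (auto simp: H_def algebra_simps)
    also have "\<dots> = v i - t * u i * (\<Sum>k<n. u k * v k)"
      using i by (simp add: sum_subtractf sum_distrib_left)
    also have "\<dots> = 0"
    proof (cases "S = 0")
      case True
      then have "u i = 0" using i by (simp add: S_def sum_nonneg_eq_0_iff)
      then show ?thesis using i by (simp add: u_def)
    next
      case False
      then have "t * (\<Sum>k<n. u k * v k) = 1" using S2 by (simp add: t_def)
      then show ?thesis using i by (simp add: u_def algebra_simps)
    qed
    finally show ?thesis .
  qed
  show thesis by (rule that[OF H orth below])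
qed

text \<open>Induction on the number of columns: a Householder reflection clears the first column below its
  top entry, and the lower right block is decomposed recursively.\<close>

lemma qr_decomposition:
  assumes "M \<in> carrier_mat m n"
  shows "\<exists>Q R. Q \<in> carrier_mat m m \<and> transpose_mat Q * Q = 1\<^sub>m m \<and>
    R \<in> carrier_mat m n \<and> upper_tri R \<and> M = Q * R"
  using assms
proof (induction n arbitrary: m M)
  case 0
  then show ?case
    by (intro exI[of _ "1\<^sub>m m"] exI[of _ M]) (auto simp: upper_tri_def)
next
  case (Suc n)
  show ?case
  proof (cases m)
    case 0
    then show ?thesis using Suc.prems
      by (intro exI[of _ "1\<^sub>m m"] exI[of _ M]) (auto simp: upper_tri_def)
  next
    case (Suc l)
    note M = Suc.prems
    obtain H where H: "H \<in> carrier_mat m m" and HTH: "transpose_mat H * H = 1\<^sub>m m"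
      and below: "\<And>i. i < m \<Longrightarrow> i \<noteq> 0 \<Longrightarrow> (\<Sum>k<m. H $$ (i, k) * M $$ (k, 0)) = 0"
      using householder[of m "\<lambda>k. M $$ (k, 0)"] by blast
    have HHT: "H * transpose_mat H = 1\<^sub>m m"
      by (rule mat_mult_left_right_inverse[OF _ H HTH]) (use H in auto)
    have HM: "H * M \<in> carrier_mat m (Suc n)" using H M by auto
    obtain a w z M' where sb: "split_block (H * M) 1 1 = (a, w, z, M')"
      by (metis prod_cases4)
    note blocks = split_block[OF sb, of l n]
    have car: "a \<in> carrier_mat 1 1" "w \<in> carrier_mat 1 n" "z \<in> carrier_mat l 1"
      "M' \<in> carrier_mat l n" and HMb: "H * M = four_block_mat a w z M'"
      using blocks H M Suc by auto
    have z: "z = 0\<^sub>m l 1"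
    proof (rule eq_matI)
      fix i j assume "i < dim_row (0\<^sub>m l 1 :: real mat)" "j < dim_col (0\<^sub>m l 1 :: real mat)"
      then have i: "Suc i < m" and j: "j = 0" using Suc by auto
      have "z $$ (i, j) = (H * M) $$ (Suc i, 0)"
        using sb i j Suc H M by (auto simp: split_block_def Let_def)
      also have "\<dots> = 0" using below[OF i] i H M by (subst mult_mat_entry[of _ m m _ "Suc n"]) auto
      finally show "z $$ (i, j) = 0\<^sub>m l 1 $$ (i, j)" using i j Suc by simp
    qed (use car in auto)
    obtain Q' R' where Q': "Q' \<in> carrier_mat l l" and QTQ': "transpose_mat Q' * Q' = 1\<^sub>m l"
      and R': "R' \<in> carrier_mat l n" and tri: "upper_tri R'" and QR': "M' = Q' * R'"
      using Suc.IH[OF car(4)] by auto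
    define B where "B = four_block_mat (1\<^sub>m 1) (0\<^sub>m 1 l) (0\<^sub>m l 1) Q'"
    define R where "R = four_block_mat a w (0\<^sub>m l 1) R'"
    have B: "B \<in> carrier_mat m m" and R: "R \<in> carrier_mat m (Suc n)"
      using four_block_carrier_mat[OF one_carrier_mat Q', of 1]
        four_block_carrier_mat[OF car(1) R'] by (simp_all add: B_def R_def Suc)
    have BT: "transpose_mat B = four_block_mat (1\<^sub>m 1) (0\<^sub>m 1 l) (0\<^sub>m l 1) (transpose_mat Q')"
      unfolding B_def
      by (subst transpose_four_block_mat[of _ 1 1 _ l _ l]) (use Q' in auto)
    have BTB: "transpose_mat B * B = 1\<^sub>m m"
    proof -
      have "transpose_mat B * B = four_block_mat (1\<^sub>m 1) (0\<^sub>m 1 l) (0\<^sub>m l 1) (1\<^sub>m l)"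
        unfolding BT unfolding B_def
        by (subst mult_four_block_mat[of _ 1 1 _ l _ l _ _ 1 _ l]) (use Q' QTQ' in auto)
      also have "\<dots> = 1\<^sub>m m" by (simp add: Suc)
      finally show ?thesis .
    qed
    have BR: "B * R = H * M"
      unfolding B_def R_def HMb
      by (subst mult_four_block_mat[of _ 1 1 _ l _ l _ _ 1 _ n]) (use car Q' R' QR' z in auto)
    let ?Q = "transpose_mat H * B"
    have Q: "?Q \<in> carrier_mat m m" using H B by auto
    have "transpose_mat ?Q * ?Q = transpose_mat B * (H * transpose_mat H * B)"
      using H B by (simp add: transpose_mult[of _ m m _ m] assoc_mult_mat[of _ m m _ m _ m])
    then have "transpose_mat ?Q * ?Q = 1\<^sub>m m" using B by (simp add: HHT BTB)
    moreover have "?Q * R = transpose_mat H * H * M"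
      using H B R M by (simp add: assoc_mult_mat[of _ m m _ m _ "Suc n"] BR)
    then have "M = ?Q * R" using M by (simp add: HTH)
    moreover have "upper_tri R"
      using tri car R' by (auto simp: upper_tri_def R_def)
    ultimately show ?thesis using Q R by blast
  qed
qed

lemma append_cols_carrier:
  "A \<in> carrier_mat m p \<Longrightarrow> B \<in> carrier_mat m q \<Longrightarrow> append_cols A B \<in> carrier_mat m (p + q)"
  unfolding append_cols_def using four_block_carrier_mat[of A m p] by fastforce

lemma append_cols_entry:
  assumes "A \<in> carrier_mat m p" "B \<in> carrier_mat m q" "i < m" "j < p + q"
  shows "append_cols A B $$ (i, j) = (if j < p then A $$ (i, j) else B $$ (i, j - p))"
  using assms by (auto simp: append_cols_def)

text \<open>The blocks \<open>[U\<^sub>1 U\<^sub>2]\<close> and \<open>[V\<^sub>1 V\<^sub>2]\<close> of a URV decomposition are cut from full orthogonal matrices.\<close>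

lemma split_cols:
  assumes M: "M \<in> carrier_mat m n" and "r \<le> n"
  obtains A B where "A \<in> carrier_mat m r" "B \<in> carrier_mat m (n - r)" "M = append_cols A B"
proof
  let ?A = "mat m r (\<lambda>ij. M $$ ij)" and ?B = "mat m (n - r) (\<lambda>(i, j). M $$ (i, j + r))"
  show "?A \<in> carrier_mat m r" "?B \<in> carrier_mat m (n - r)" by auto
  have "append_cols ?A ?B \<in> carrier_mat m n"
    using append_cols_carrier[of ?A m r ?B "n - r"] assms by auto
  then show "M = append_cols ?A ?B"
    using assms by (intro eq_matI) (auto simp: append_cols_entry[of _ m r _ "n - r"])
qed

lemma gram_append_cols:
  assumes A: "A \<in> carrier_mat m p" and B: "B \<in> carrier_mat m q"
    and orth: "transpose_mat (append_cols A B) * append_cols A B = 1\<^sub>m (p + q)"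
  shows "transpose_mat A * A = 1\<^sub>m p" "transpose_mat B * A = 0\<^sub>m q p"
proof -
  let ?V = "append_cols A B"
  have V: "?V \<in> carrier_mat m (p + q)" using A B by (rule append_cols_carrier)
  have gram: "(\<Sum>k<m. ?V $$ (k, i) * ?V $$ (k, j)) = (if i = j then 1 else 0)"
    if "i < p + q" "j < p + q" for i j
  proof -
    have "(\<Sum>k<m. ?V $$ (k, i) * ?V $$ (k, j)) = (transpose_mat ?V * ?V) $$ (i, j)"
      using V that by (subst mult_mat_entry[of _ "p + q" m _ "p + q"]) auto
    then show ?thesis using that by (simp add: orth)
  qed
  show "transpose_mat A * A = 1\<^sub>m p"
  proof (rule eq_matI)
    fix i j assume "i < dim_row (1\<^sub>m p :: real mat)" "j < dim_col (1\<^sub>m p :: real mat)"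
    then have ij: "i < p" "j < p" by auto
    have "(transpose_mat A * A) $$ (i, j) = (\<Sum>k<m. A $$ (k, i) * A $$ (k, j))"
      using A ij by (subst mult_mat_entry[of _ p m _ p]) auto
    also have "\<dots> = (\<Sum>k<m. ?V $$ (k, i) * ?V $$ (k, j))"
      using ij by (intro sum.cong) (auto simp: append_cols_entry[OF A B])
    finally show "(transpose_mat A * A) $$ (i, j) = 1\<^sub>m p $$ (i, j)"
      using gram[of i j] ij by simp
  qed (use A in auto)
  show "transpose_mat B * A = 0\<^sub>m q p"
  proof (rule eq_matI)
    fix i j assume "i < dim_row (0\<^sub>m q p :: real mat)" "j < dim_col (0\<^sub>m q p :: real mat)"
    then have ij: "i < q" "j < p" by auto
    have "(transpose_mat B * A) $$ (i, j) = (\<Sum>k<m. B $$ (k, i) * A $$ (k, j))"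
      using A B ij by (subst mult_mat_entry[of _ q m _ p]) auto
    also have "\<dots> = (\<Sum>k<m. ?V $$ (k, p + i) * ?V $$ (k, j))"
      using ij by (intro sum.cong) (auto simp: append_cols_entry[OF A B])
    finally show "(transpose_mat B * A) $$ (i, j) = 0\<^sub>m q p $$ (i, j)"
      using gram[of "p + i" j] ij by simp
  qed (use A B in auto)
qed

lemma urv_carriers:
  assumes "is_urv A r D" and "A \<in> carrier_mat m n"
  shows "U1 D \<in> carrier_mat m r" "R11 D \<in> carrier_mat r r" "V1 D \<in> carrier_mat n r"
    "V2 D \<in> carrier_mat n (n - r)" "urv_residual D \<in> carrier_mat m n" "r \<le> m" "r \<le> n"
  using assms by (auto simp: is_urv_def Let_def urv_residual_def)

lemma urv_V1_isometry:
  assumes "is_urv A r D" and "A \<in> carrier_mat m n"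
  shows "transpose_mat (V1 D) * V1 D = 1\<^sub>m r" "transpose_mat (V2 D) * V1 D = 0\<^sub>m (n - r) r"
proof -
  have "r + (n - r) = n" using urv_carriers[OF assms] by simp
  then have "transpose_mat (append_cols (V1 D) (V2 D)) * append_cols (V1 D) (V2 D) = 1\<^sub>m (r + (n - r))"
    using assms by (auto simp: is_urv_def Let_def)
  from gram_append_cols[OF urv_carriers(3,4)[OF assms] this]
  show "transpose_mat (V1 D) * V1 D = 1\<^sub>m r" "transpose_mat (V2 D) * V1 D = 0\<^sub>m (n - r) r" .
qed

lemma urv_residual_mult_V1:
  assumes "is_urv A r D" and "A \<in> carrier_mat m n"
  shows "urv_residual D * V1 D = 0\<^sub>m m r"
proof -
  note c = urv_carriers[OF assms]
  let ?B = "U1 D * R12 D + U2 D * R22 D"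
  have B: "?B \<in> carrier_mat m (n - r)"
    using assms by (auto simp: is_urv_def Let_def)
  have "urv_residual D * V1 D = ?B * (transpose_mat (V2 D) * V1 D)"
    unfolding urv_residual_def by (rule assoc_mult_mat[OF B]) (use c in auto)
  then show ?thesis by (simp add: urv_V1_isometry[OF assms] right_mult_zero_mat[OF B])
qed

text \<open>The matrix passed on to the next step of the sweep is thus a right multiple of the current one.\<close>

lemma urv_mult_V1:
  assumes "is_urv A r D" and "A \<in> carrier_mat m n"
  shows "A * V1 D = U1 D * R11 D"
proof -
  note c = urv_carriers[OF assms]
  let ?Y = "U1 D * R11 D"
  have Y: "?Y \<in> carrier_mat m r" using c by auto
  have "A * V1 D = (?Y * transpose_mat (V1 D) + urv_residual D) * V1 D"
    using urv_truncation_residual(1)[OF assms(1)] by simp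
  also have "\<dots> = ?Y * transpose_mat (V1 D) * V1 D + 0\<^sub>m m r"
    using c Y by (simp add: add_mult_distrib_mat[of _ m n] urv_residual_mult_V1[OF assms])
  also have "?Y * transpose_mat (V1 D) * V1 D = ?Y * (transpose_mat (V1 D) * V1 D)"
    by (rule assoc_mult_mat[OF Y]) (use c in auto)
  finally show ?thesis using Y
    by (simp add: urv_V1_isometry[OF assms] right_mult_one_mat[OF Y] right_add_zero_mat[OF Y])
qed

text \<open>Replacing \<open>U\<^sub>1 R\<^sub>1\<^sub>1\<close> by an arbitrary \<open>Z\<close> adds the error \<open>(U\<^sub>1 R\<^sub>1\<^sub>1 - Z) V\<^sub>1\<^sup>T\<close> to the residual, and
  the residual is orthogonal to it. In the sweep \<open>Z\<close> is the approximation of \<open>U\<^sub>1 R\<^sub>1\<^sub>1\<close> made by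
  the remaining steps.\<close>

lemma urv_error_split:
  assumes urv: "is_urv A r D" and A: "A \<in> carrier_mat m n" and Z: "Z \<in> carrier_mat m r"
  shows "(frob (A - Z * transpose_mat (V1 D)))\<^sup>2
    = (frob (urv_residual D))\<^sup>2 + (frob (U1 D * R11 D - Z))\<^sup>2"
proof -
  note c = urv_carriers[OF urv A]
  let ?E = "urv_residual D" and ?Y = "U1 D * R11 D" and ?VT = "transpose_mat (V1 D)"
  have Y: "?Y \<in> carrier_mat m r" and VT: "?VT \<in> carrier_mat r n" using c by auto
  have car: "?Y * ?VT \<in> carrier_mat m n" "Z * ?VT \<in> carrier_mat m n" using Y Z VT by auto
  have "A - Z * ?VT = ?Y * ?VT + ?E - Z * ?VT"
    using urv_truncation_residual(1)[OF urv] by simp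
  also have "\<dots> = ?E + (?Y * ?VT - Z * ?VT)"
  proof -
    have "L + E - M = E + (L - M)"
      if "L \<in> carrier_mat m n" "E \<in> carrier_mat m n" "M \<in> carrier_mat m n" for L E M :: "real mat"
      using that by (intro eq_matI) auto
    then show ?thesis using car c(5) by blast
  qed
  also have "?Y * ?VT - Z * ?VT = (?Y - Z) * ?VT"
    by (rule minus_mult_distrib_mat[OF Y Z VT, symmetric])
  finally show ?thesis
    using frob_sq_isometry_split[OF c(5) _ c(3) urv_V1_isometry(1)[OF urv A] urv_residual_mult_V1[OF urv A]]
      minus_carrier_mat[OF Z, of ?Y] by simp
qed

text \<open>The truncated decomposition is the best approximation with rows in the column space of \<open>V\<^sub>1\<close>.\<close>

lemma urv_residual_le:
  assumes "is_urv A r D" and "A \<in> carrier_mat m n" and "Z \<in> carrier_mat m r"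
  shows "frob (urv_residual D) \<le> frob (A - Z * transpose_mat (V1 D))"
proof (rule power2_le_imp_le)
  show "(frob (urv_residual D))\<^sup>2 \<le> (frob (A - Z * transpose_mat (V1 D)))\<^sup>2"
    unfolding urv_error_split[OF assms] by simp
qed (rule frob_nonneg)

text \<open>The leading block of \<open>V\<close> can be made to span any given \<open>r\<close> columns: \<open>V\<close> is taken from a QR
  decomposition of \<open>T\<close>, and \<open>U\<close> with the triangular middle factor from one of \<open>A V\<close>.\<close>

lemma urv_prescribed_range:
  assumes A: "A \<in> carrier_mat m n" and r: "r \<le> m" "r \<le> n" and T: "T \<in> carrier_mat n r"
  obtains D S where "is_urv A r D" "S \<in> carrier_mat r r" "T = V1 D * S"
proof -
  obtain V P where V: "V \<in> carrier_mat n n" and VTV: "transpose_mat V * V = 1\<^sub>m n"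
    and P: "P \<in> carrier_mat n r" "upper_tri P" and TVP: "T = V * P"
    using qr_decomposition[OF T] by blast
  have VVT: "V * transpose_mat V = 1\<^sub>m n"
    by (rule mat_mult_left_right_inverse[OF _ V VTV]) (use V in auto)
  obtain U R where U: "U \<in> carrier_mat m m" and UTU: "transpose_mat U * U = 1\<^sub>m m"
    and R: "R \<in> carrier_mat m n" "upper_tri R" and AV: "A * V = U * R"
    using qr_decomposition[of "A * V" m n] A V by auto
  obtain U\<^sub>1 U\<^sub>2 where Us: "U\<^sub>1 \<in> carrier_mat m r" "U\<^sub>2 \<in> carrier_mat m (m - r)" "U = append_cols U\<^sub>1 U\<^sub>2"
    using split_cols[OF U r(1)] .
  obtain V\<^sub>1 V\<^sub>2 where Vs: "V\<^sub>1 \<in> carrier_mat n r" "V\<^sub>2 \<in> carrier_mat n (n - r)" "V = append_cols V\<^sub>1 V\<^sub>2"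
    using split_cols[OF V r(2)] .
  obtain A1 A2 A3 A4 where sb: "split_block R r r = (A1, A2, A3, A4)"
    by (metis prod_cases4)
  have blocks: "A1 \<in> carrier_mat r r" "A2 \<in> carrier_mat r (n - r)"
    "A3 \<in> carrier_mat (m - r) r" "A4 \<in> carrier_mat (m - r) (n - r)"
    "R = four_block_mat A1 A2 A3 A4"
    using split_block[OF sb, of "m - r" "n - r"] R r by auto
  have A3: "A3 = 0\<^sub>m (m - r) r"
    by (rule eq_matI) (use sb R r in \<open>auto simp: split_block_def Let_def upper_tri_def\<close>)
  have tri: "upper_tri A1" "upper_tri A4"
    using sb R r by (auto simp: split_block_def Let_def upper_tri_def)
  have "A = A * (V * transpose_mat V)" using A by (simp add: VVT)
  also have "\<dots> = U * R * transpose_mat V"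
    using A V by (simp add: AV[symmetric] assoc_mult_mat[of _ m n _ n _ n])
  finally have AURV: "A = U * R * transpose_mat V" .
  define D where "D = \<lparr>U1 = U\<^sub>1, U2 = U\<^sub>2, R11 = A1, R12 = A2, R22 = A4, V1 = V\<^sub>1, V2 = V\<^sub>2\<rparr>"
  have dims: "dim_row A = m" "dim_col A = n" using A by auto
  have "is_urv A r D"
    unfolding is_urv_def Let_def D_def dims
    using r Us Vs blocks A3 tri UTU VTV AURV by simp
  moreover define S where "S = mat r r (\<lambda>ij. P $$ ij)"
  moreover have "T = V\<^sub>1 * S"
  proof (rule eq_matI)
    fix i j assume "i < dim_row (V\<^sub>1 * S)" "j < dim_col (V\<^sub>1 * S)"
    then have i: "i < n" and j: "j < r" using Vs by (auto simp: S_def)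
    have "T $$ (i, j) = (\<Sum>k<n. V $$ (i, k) * P $$ (k, j))"
      unfolding TVP by (rule mult_mat_entry[OF V P(1) i j])
    \<comment> \<open>\<open>P\<close> has only \<open>r\<close> columns, so its rows from \<open>r\<close> on lie below the diagonal and vanish.\<close>
    also have "\<dots> = (\<Sum>k<r. V $$ (i, k) * P $$ (k, j))"
      using r j P by (intro sum.mono_neutral_right) (auto simp: upper_tri_def)
    also have "\<dots> = (\<Sum>k<r. V\<^sub>1 $$ (i, k) * S $$ (k, j))"
      using i j r Vs by (intro sum.cong) (auto simp: append_cols_entry[OF Vs(1,2)] S_def)
    also have "\<dots> = (V\<^sub>1 * S) $$ (i, j)"
      by (rule mult_mat_entry[OF Vs(1) _ i j, symmetric]) (simp add: S_def)
    finally show "T $$ (i, j) = (V\<^sub>1 * S) $$ (i, j)" .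
  qed (use T Vs in \<open>auto simp: S_def\<close>)
  ultimately show thesis using that[of D S] by (simp add: D_def S_def)
qed

text \<open>\<open>K\<close> compresses the columns of \<open>A\<close>. The compressed truncation of \<open>D\<close> approximates \<open>A K\<close> with the
  compressed residual as its error, and its rows lie in the column space of \<open>K\<^sup>T V1 D\<close>. So \<open>F\<close> does
  at least as well if the columns of \<open>V1 F\<close> span a space containing that one.\<close>

lemma urv_of_compression:
  assumes urv: "is_urv A r D" and A: "A \<in> carrier_mat m n"
    and K: "K \<in> carrier_mat n q" and iso: "transpose_mat K * K = 1\<^sub>m q" and r: "r \<le> q"
  obtains F where "is_urv (A * K) r F" "frob (urv_residual F) \<le> frob (urv_residual D)"
proof -
  note c = urv_carriers[OF urv A]
  let ?Y = "U1 D * R11 D" and ?T = "transpose_mat K * V1 D"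
  have Y: "?Y \<in> carrier_mat m r" and AK: "A * K \<in> carrier_mat m q" and T: "?T \<in> carrier_mat q r"
    using c A K by auto
  obtain F S where F: "is_urv (A * K) r F" and S: "S \<in> carrier_mat r r" and TVS: "?T = V1 F * S"
    using urv_prescribed_range[OF AK c(6) r T] .
  note cF = urv_carriers[OF F AK]
  have "frob (urv_residual F) \<le> frob (A * K - ?Y * transpose_mat S * transpose_mat (V1 F))"
    by (rule urv_residual_le[OF F AK]) (use Y S in auto)
  also have "?Y * transpose_mat S * transpose_mat (V1 F) = ?Y * transpose_mat (V1 F * S)"
    using Y S cF(3) by (simp add: transpose_mult[OF cF(3) S] assoc_mult_mat[OF Y, of _ r _ q])
  also have "\<dots> = ?Y * (transpose_mat (V1 D) * K)"
    unfolding TVS[symmetric] using K c by (simp add: transpose_mult[of _ q n _ r])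
  also have "\<dots> = ?Y * transpose_mat (V1 D) * K"
    by (rule assoc_mult_mat[OF Y, symmetric]) (use K c in auto)
  also have "A * K - \<dots> = (A - ?Y * transpose_mat (V1 D)) * K"
    by (rule minus_mult_distrib_mat[OF A _ K, symmetric]) (use Y c in auto)
  also have "A - ?Y * transpose_mat (V1 D) = urv_residual D"
    by (rule urv_truncation_residual(2)[OF urv, symmetric])
  also have "frob (urv_residual D * K) \<le> frob (urv_residual D)"
    by (rule frob_mult_isometry_le[OF c(5) K iso])
  finally show thesis using that[OF F] by blast
qed

section \<open>The error of a run\<close>

text \<open>The row vector \<open>G\<^sub>1(i\<^sub>1) \<cdots> G\<^sub>k(i\<^sub>k)\<close> of the matrix product form of a TT tensor. The empty product
  is the vector of ones, which is right for \<open>r 0 = 1\<close>.\<close>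

primrec tt_prefix ::
  "(nat \<Rightarrow> nat) \<Rightarrow> (nat \<Rightarrow> nat \<Rightarrow> nat \<Rightarrow> nat \<Rightarrow> real) \<Rightarrow> (nat \<Rightarrow> nat) \<Rightarrow> nat \<Rightarrow> nat \<Rightarrow> real" where
  "tt_prefix r G i 0 \<beta> = 1"
| "tt_prefix r G i (Suc k) \<beta> = (\<Sum>\<alpha><r k. tt_prefix r G i k \<alpha> * G (Suc k) \<alpha> (i (Suc k)) \<beta>)"

lemma sum_PiE_insert:
  assumes "x \<notin> S"
  shows "(\<Sum>\<alpha>\<in>PiE (insert x S) T. h \<alpha>) = (\<Sum>g\<in>PiE S T. \<Sum>y\<in>T x. h (g(x := y)))"
proof -
  have "(\<Sum>\<alpha>\<in>PiE (insert x S) T. h \<alpha>) = (\<Sum>(y, g)\<in>T x \<times> PiE S T. h (g(x := y)))"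
    unfolding PiE_insert_eq
    by (subst sum.reindex[OF inj_combinator[OF assms]]) (simp add: case_prod_unfold)
  also have "\<dots> = (\<Sum>y\<in>T x. \<Sum>g\<in>PiE S T. h (g(x := y)))"
    by (rule sum.cartesian_product[symmetric])
  also have "\<dots> = (\<Sum>g\<in>PiE S T. \<Sum>y\<in>T x. h (g(x := y)))" by (rule sum.swap)
  finally show ?thesis .
qed

text \<open>The weight \<open>f\<close> on the last rank index makes the induction go through: the core split off in a step
  becomes part of the weight for the shorter paths.\<close>

lemma sum_paths_eq_tt_prefix:
  "(\<Sum>\<alpha>\<in>PiE {0..k} (\<lambda>l. {..<r l}). (\<Prod>l=1..k. G l (\<alpha> (l - 1)) (i l) (\<alpha> l)) * f (\<alpha> k))
    = (\<Sum>\<beta><r k. tt_prefix r G i k \<beta> * f \<beta>)"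
proof (induction k arbitrary: f)
  case 0
  show ?case using sum_PiE_insert[of 0 "{}" "\<lambda>\<alpha>. f (\<alpha> 0)" "\<lambda>l. {..<r l}"] by simp
next
  case (Suc k)
  let ?T = "\<lambda>l. {..<r l}"
  have last: "sum h (PiE {0..Suc k} ?T) = (\<Sum>g\<in>PiE {0..k} ?T. \<Sum>y<r (Suc k). h (g(Suc k := y)))" for h
    unfolding atLeast0_atMost_Suc by (rule sum_PiE_insert) simp
  have "(\<Prod>l=1..Suc k. G l ((g(Suc k := y)) (l - 1)) (i l) ((g(Suc k := y)) l))
      = (\<Prod>l=1..k. G l (g (l - 1)) (i l) (g l)) * G (Suc k) (g k) (i (Suc k)) y" for g y
  proof -
    have "(\<Prod>l=1..k. G l ((g(Suc k := y)) (l - 1)) (i l) ((g(Suc k := y)) l))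
      = (\<Prod>l=1..k. G l (g (l - 1)) (i l) (g l))" by (rule prod.cong) auto
    then show ?thesis by simp
  qed
  then have "(\<Sum>\<alpha>\<in>PiE {0..Suc k} ?T. (\<Prod>l=1..Suc k. G l (\<alpha> (l - 1)) (i l) (\<alpha> l)) * f (\<alpha> (Suc k)))
      = (\<Sum>g\<in>PiE {0..k} ?T. \<Sum>y<r (Suc k).
          (\<Prod>l=1..k. G l (g (l - 1)) (i l) (g l)) * G (Suc k) (g k) (i (Suc k)) y * f y)"
    by (simp only: last fun_upd_same)
  also have "\<dots> = (\<Sum>g\<in>PiE {0..k} ?T. (\<Prod>l=1..k. G l (g (l - 1)) (i l) (g l))
      * (\<Sum>y<r (Suc k). G (Suc k) (g k) (i (Suc k)) y * f y))"
    by (simp only: sum_distrib_left mult.assoc)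
  also have "\<dots> = (\<Sum>\<beta><r k. tt_prefix r G i k \<beta> * (\<Sum>y<r (Suc k). G (Suc k) \<beta> (i (Suc k)) y * f y))"
    by (rule Suc.IH)
  also have "\<dots> = (\<Sum>y<r (Suc k). tt_prefix r G i (Suc k) y * f y)"
    by (simp add: sum_distrib_left sum_distrib_right mult.assoc) (rule sum.swap)
  finally show ?case .
qed

lemma tt_tensor_eq_tt_prefix:
  assumes "r d = 1"
  shows "tt_tensor d r G i = tt_prefix r G i d 0"
  using sum_paths_eq_tt_prefix[where k = d and f = "\<lambda>_. 1"] assms by (simp add: tt_tensor_def)

text \<open>\<open>Z\<close> is the product of the cores \<open>1, \<dots>, k\<close>, the approximation of \<open>C k\<close> that the rest of the
  sweep arrives at. \<open>C k\<close> is reshaped because for \<open>k = d\<close> it has the shape of the unfolding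
  \<open>d - 1\<close>; for smaller \<open>k\<close> it has the stated shape already.\<close>

lemma tt_urv_prefix_error:
  assumes run: "tt_urv_run d I r X C F G" and r0: "r 0 = 1" and "1 \<le> k" "k \<le> d"
  shows "\<exists>Z \<in> carrier_mat (\<Prod>l=1..k. I l) (r k).
    (\<forall>i \<beta>. (\<forall>l\<in>{1..k}. i l < I l) \<longrightarrow> \<beta> < r k \<longrightarrow> Z $$ (merge I 1 k i, \<beta>) = tt_prefix r G i k \<beta>) \<and>
    (frob (reshape_mat (C k) (\<Prod>l=1..k. I l) (r k) - Z))\<^sup>2 = (\<Sum>l=2..k. (frob (urv_residual (F l)))\<^sup>2)"
  using assms(3,4)
proof (induction k rule: nat_induct_at_least)
  case base
  have G: "G 1 = reshape3 (C 1) 1 (I 1) (r 1)" using run by (simp add: tt_urv_run_def)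
  let ?Z = "reshape_mat (C 1) (I 1) (r 1)"
  have "?Z - ?Z = 0\<^sub>m (I 1) (r 1)" by (rule minus_r_inv_mat) simp
  then have "frob (?Z - ?Z) = 0" by (simp add: frob_def)
  then show ?case
    using r0 G by (intro bexI[of _ ?Z]) (auto simp: merge_def reshape_mat_entry reshape3_def)
next
  case (Suc k)
  define N where "N j = (\<Prod>l=1..j. I l)" for j
  have N_Suc: "N (Suc k) = N k * I (Suc k)" by (simp add: N_def)
  let ?I = "I (Suc k)" and ?r = "r (Suc k)" and ?F = "F (Suc k)" and ?VT = "transpose_mat (V1 (F (Suc k)))"
  let ?B = "reshape_mat (C (Suc k)) (N k) (?I * ?r)"
  have B: "?B \<in> carrier_mat (N k) (?I * ?r)" by simp
  have "Suc k \<in> {2..d}" using Suc by auto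
  with run have "is_urv (reshape_mat (C (Suc k)) (\<Prod>l=1..Suc k-1. I l) (?I * ?r)) (r (Suc k - 1)) ?F \<and>
      G (Suc k) = reshape3 ?VT (r (Suc k - 1)) ?I ?r \<and> C (Suc k - 1) = U1 ?F * R11 ?F"
    unfolding tt_urv_run_def by blast
  then have urv: "is_urv ?B (r k) ?F" and G: "G (Suc k) = reshape3 ?VT (r k) ?I ?r"
    and Ck: "C k = U1 ?F * R11 ?F"
    by (simp_all add: N_def)
  note c = urv_carriers[OF urv B]
  have VT: "?VT \<in> carrier_mat (r k) (?I * ?r)" using c by simp
  have "C k \<in> carrier_mat (N k) (r k)" using c Ck by auto
  then have Ck': "reshape_mat (C k) (N k) (r k) = C k" by (rule reshape_mat_id)
  obtain Z where Z: "Z \<in> carrier_mat (N k) (r k)"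
    and Zentry: "\<And>i \<beta>. (\<And>l. l \<in> {1..k} \<Longrightarrow> i l < I l) \<Longrightarrow> \<beta> < r k \<Longrightarrow>
      Z $$ (merge I 1 k i, \<beta>) = tt_prefix r G i k \<beta>"
    and Zerr: "(frob (C k - Z))\<^sup>2 = (\<Sum>l=2..k. (frob (urv_residual (F l)))\<^sup>2)"
    using Suc.IH[OF Suc_leD[OF Suc.prems], folded N_def, unfolded Ck'] by blast
  have ZV: "Z * ?VT \<in> carrier_mat (N k) (?I * ?r)" using Z VT by auto
  have sizes: "N k * (?I * ?r) = N (Suc k) * ?r" by (simp add: N_Suc)
  \<comment> \<open>Undoing the step: the product of the cores up to \<open>k\<close> is multiplied by core \<open>k + 1\<close>.\<close>
  define Z' where "Z' = reshape_mat (Z * ?VT) (N (Suc k)) ?r"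
  have entry: "Z' $$ (merge I 1 (Suc k) i, \<beta>) = tt_prefix r G i (Suc k) \<beta>"
    if i: "\<And>l. l \<in> {1..Suc k} \<Longrightarrow> i l < I l" and \<beta>: "\<beta> < ?r" for i \<beta>
  proof -
    let ?p = "merge I 1 k i" and ?j = "i (Suc k)"
    have p: "?p < N k"
      using merge_less[of 1 k i I] i by (simp add: N_def atLeastLessThanSuc_atLeastAtMost)
    have j: "?j < ?I" using i by simp
    have q: "?j + \<beta> * ?I < ?I * ?r" by (rule pair_number_less[OF j \<beta>])
    have mrg: "merge I 1 (Suc k) i = ?p + ?j * N k"
      by (simp add: merge_Suc N_def atLeastLessThanSuc_atLeastAtMost)
    have "?p + ?j * N k < N (Suc k)" unfolding N_Suc by (rule pair_number_less[OF p j])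
    then have "Z' $$ (merge I 1 (Suc k) i, \<beta>) = flat (Z * ?VT) (?p + ?j * N k + \<beta> * N (Suc k))"
      unfolding Z'_def mrg using \<beta> by (rule reshape_mat_entry)
    also have "?p + ?j * N k + \<beta> * N (Suc k) = ?p + (?j + \<beta> * ?I) * N k"
      by (simp add: N_Suc algebra_simps)
    also have "flat (Z * ?VT) \<dots> = (Z * ?VT) $$ (?p, ?j + \<beta> * ?I)"
      by (rule flat_pair[OF ZV p])
    also have "\<dots> = (\<Sum>\<alpha><r k. Z $$ (?p, \<alpha>) * ?VT $$ (\<alpha>, ?j + \<beta> * ?I))"
      by (rule mult_mat_entry[OF Z VT p q])
    also have "\<dots> = (\<Sum>\<alpha><r k. tt_prefix r G i k \<alpha> * G (Suc k) \<alpha> ?j \<beta>)"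
    proof (rule sum.cong[OF refl])
      fix \<alpha> assume "\<alpha> \<in> {..<r k}"
      then have \<alpha>: "\<alpha> < r k" by simp
      have num: "\<alpha> + ?j * r k + \<beta> * (r k * ?I) = \<alpha> + (?j + \<beta> * ?I) * r k"
        by (simp add: algebra_simps)
      have "G (Suc k) \<alpha> ?j \<beta> = ?VT $$ (\<alpha>, ?j + \<beta> * ?I)"
        unfolding G reshape3_def num by (rule flat_pair[OF VT \<alpha>])
      then show "Z $$ (?p, \<alpha>) * ?VT $$ (\<alpha>, ?j + \<beta> * ?I) = tt_prefix r G i k \<alpha> * G (Suc k) \<alpha> ?j \<beta>"
        using Zentry[of i \<alpha>] i \<alpha> by simp
    qed
    finally show ?thesis by simp
  qed
  have "(frob (reshape_mat (C (Suc k)) (N (Suc k)) ?r - Z'))\<^sup>2 = (frob (?B - Z * ?VT))\<^sup>2"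
    unfolding Z'_def reshape_reshape_mat[OF sizes[symmetric], of "C (Suc k)", symmetric]
    by (rule frob_sq_diff_reshape_mat[OF B ZV sizes])
  also have "\<dots> = (frob (urv_residual ?F))\<^sup>2 + (frob (C k - Z))\<^sup>2"
    unfolding Ck by (rule urv_error_split[OF urv B Z])
  also have "\<dots> = (\<Sum>l=2..Suc k. (frob (urv_residual (F l)))\<^sup>2)"
    using Suc.hyps by (simp add: Zerr)
  finally show ?case
    unfolding N_def[symmetric] using entry by (intro bexI[of _ Z']) (auto simp: Z'_def)
qed

lemma tt_urv_error:
  assumes run: "tt_urv_run d I r X C F G" and d: "1 \<le> d" and r: "r 0 = 1" "r d = 1"
  shows "(tensor_frob d I (\<lambda>i. X i - tt_tensor d r G i))\<^sup>2
    = (\<Sum>k=2..d. (frob (urv_residual (F k)))\<^sup>2)"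
proof -
  obtain Z where Z: "Z \<in> carrier_mat (\<Prod>l=1..d. I l) 1"
    and entry: "\<And>i. (\<And>l. l \<in> {1..d} \<Longrightarrow> i l < I l) \<Longrightarrow> Z $$ (merge I 1 d i, 0) = tt_prefix r G i d 0"
    and err: "(frob (reshape_mat (C d) (\<Prod>l=1..d. I l) 1 - Z))\<^sup>2
      = (\<Sum>k=2..d. (frob (urv_residual (F k)))\<^sup>2)"
    using tt_urv_prefix_error[OF run r(1) d order.refl] unfolding r(2) by auto
  let ?T = "tt_tensor d r G"
  have "Z = unfolding_mat d I ?T d"
  proof (rule unfolding_mat_eqI)
    fix i assume i: "i \<in> multi_indices d I"
    then have less: "\<And>l. l \<in> {1..d} \<Longrightarrow> i l < I l" by (auto simp: multi_indices_def)
    have "merge I 1 d i < (\<Prod>l=1..d. I l)"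
      using bij_betwE[OF merge_bij[of I d]] i by auto
    then have "flat Z (merge I 1 d i) = Z $$ (merge I 1 d i, 0)"
      using flat_pair[OF Z, of "merge I 1 d i" 0] by simp
    then show "flat Z (merge I 1 d i) = ?T i"
      using entry[OF less] by (simp add: tt_tensor_eq_tt_prefix[of r d, OF r(2)])
  qed (use Z in auto)
  moreover have "reshape_mat (C d) (\<Prod>l=1..d. I l) 1 = unfolding_mat d I X d"
    using run reshape_unfolding_mat[of d d "d - 1" I X] by (simp add: tt_urv_run_def)
  moreover have "unfolding_mat d I X d - unfolding_mat d I ?T d = unfolding_mat d I (\<lambda>i. X i - ?T i) d"
    by (rule eq_matI) (auto simp: unfolding_mat_def)
  ultimately show ?thesis
    using err tensor_frob_sq_unfolding[of d d I "\<lambda>i. X i - ?T i"] by simp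
qed

section \<open>A run with small residuals\<close>

text \<open>The sweep maintains \<open>compressed\<close>: the current matrix, reshaped, is the unfolding times a matrix \<open>W\<close> with
  orthonormal columns. By \<open>urv_of_compression\<close> this lets every step do at least as well as the
  given decomposition of the unfolding.\<close>

lemma tt_urv_run_exists:
  assumes d: "1 \<le> d" and rd: "r d = 1"
    and ranks: "\<And>k. k \<in> {2..d} \<Longrightarrow> r (k - 1) \<le> I k * r k"
    and urv: "\<And>k. k \<in> {1..d-1} \<Longrightarrow> is_urv (unfolding_mat d I X k) (r k) (D k)"
  shows "\<exists>C F G. tt_urv_run d I r X C F G \<and>
    (\<forall>k\<in>{2..d}. frob (urv_residual (F k)) \<le> frob (urv_residual (D (k - 1))))"
proof -
  define N where "N k = (\<Prod>l=1..k. I l)" for k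
  define M where "M k = (\<Prod>l=k+1..d. I l)" for k
  define A where "A = unfolding_mat d I X"
  have A: "A k \<in> carrier_mat (N k) (M k)" for k
    unfolding A_def N_def M_def by (rule unfolding_mat_carrier)
  have A_reshape: "reshape_mat (A k) (N j) (M j) = A j" if "j \<le> d" "k \<le> d" for j k
    unfolding A_def N_def M_def by (rule reshape_unfolding_mat[OF that])
  define compressed where "compressed k Y \<longleftrightarrow> (\<exists>W \<in> carrier_mat (M k) (r k).
      transpose_mat W * W = 1\<^sub>m (r k) \<and> reshape_mat Y (N k) (r k) = A k * W)" for k Y
  define good_step where "good_step k Y F \<longleftrightarrow> is_urv (reshape_mat Y (N (k - 1)) (I k * r k)) (r (k - 1)) F \<and>
      frob (urv_residual F) \<le> frob (urv_residual (D (k - 1)))" for k Y F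
  have start: "compressed d (A (d - 1))"
  proof -
    have Md: "M d = 1" by (simp add: M_def)
    have "reshape_mat (A (d - 1)) (N d) (r d) = A d * 1\<^sub>m 1"
      using A_reshape[of d "d - 1"] right_mult_one_mat[OF A[of d]] by (simp add: Md rd)
    then show ?thesis
      unfolding compressed_def Md rd by (intro bexI[of _ "1\<^sub>m 1"]) auto
  qed
  have step: "\<exists>F. good_step k Y F \<and> compressed (k - 1) (U1 F * R11 F)"
    if k: "k \<in> {2..d}" and Y: "compressed k Y" for k Y
  proof -
    let ?m = "N (k - 1)"
    have Nk: "N k = ?m * I k" and Mk: "M (k - 1) = I k * M k"
      using k by (cases k; simp add: N_def)
        (use k in \<open>simp add: M_def prod.atLeast_Suc_atMost\<close>)
    obtain W where W: "W \<in> carrier_mat (M k) (r k)" "transpose_mat W * W = 1\<^sub>m (r k)"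
      and YW: "reshape_mat Y (N k) (r k) = A k * W"
      using Y by (auto simp: compressed_def)
    let ?K = "kron_id (I k) W"
    have K: "?K \<in> carrier_mat (M (k - 1)) (I k * r k)" unfolding Mk by (rule kron_id_carrier[OF W(1)])
    have isoK: "transpose_mat ?K * ?K = 1\<^sub>m (I k * r k)" by (rule kron_id_isometry[OF W])
    have Ak: "A k \<in> carrier_mat (?m * I k) (M k)" using A[of k] by (simp add: Nk)
    have "reshape_mat Y ?m (I k * r k) = reshape_mat (reshape_mat Y (N k) (r k)) ?m (I k * r k)"
      by (rule reshape_reshape_mat[symmetric]) (simp add: Nk)
    also have "\<dots> = reshape_mat (A k) ?m (I k * M k) * ?K"
      unfolding YW by (rule reshape_mult_eq_mult_kron_id[OF Ak W(1)])
    also have "reshape_mat (A k) ?m (I k * M k) = A (k - 1)"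
      unfolding Mk[symmetric] by (rule A_reshape) (use k in auto)
    finally have B: "reshape_mat Y ?m (I k * r k) = A (k - 1) * ?K" .
    have "k - 1 \<in> {1..d-1}" using k by auto
    then have "is_urv (A (k - 1)) (r (k - 1)) (D (k - 1))" unfolding A_def by (rule urv)
    from urv_of_compression[OF this A K isoK ranks[OF k]]
    obtain F where F: "is_urv (A (k - 1) * ?K) (r (k - 1)) F"
      and err: "frob (urv_residual F) \<le> frob (urv_residual (D (k - 1)))" .
    have AK: "A (k - 1) * ?K \<in> carrier_mat ?m (I k * r k)" by (rule mult_carrier_mat[OF A K])
    note c = urv_carriers[OF F AK]
    have V: "V1 F \<in> carrier_mat (I k * r k) (r (k - 1))" by (rule c(3))
    have KV: "?K * V1 F \<in> carrier_mat (M (k - 1)) (r (k - 1))" by (rule mult_carrier_mat[OF K V])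
    have "transpose_mat (?K * V1 F) * (?K * V1 F)
        = transpose_mat (V1 F) * (transpose_mat ?K * (?K * V1 F))"
      unfolding transpose_mult[OF K V] by (rule assoc_mult_mat) (use K V KV in auto)
    also have "transpose_mat ?K * (?K * V1 F) = transpose_mat ?K * ?K * V1 F"
      by (rule assoc_mult_mat[symmetric]) (use K V in auto)
    also have "\<dots> = V1 F" unfolding isoK by (rule left_mult_one_mat[OF V])
    finally have isoKV: "transpose_mat (?K * V1 F) * (?K * V1 F) = 1\<^sub>m (r (k - 1))"
      by (simp add: urv_V1_isometry[OF F AK])
    have "U1 F * R11 F = A (k - 1) * (?K * V1 F)"
      unfolding urv_mult_V1[OF F AK, symmetric] by (rule assoc_mult_mat[OF A K V])
    moreover have "U1 F * R11 F \<in> carrier_mat ?m (r (k - 1))" using c by auto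
    ultimately have "reshape_mat (U1 F * R11 F) ?m (r (k - 1)) = A (k - 1) * (?K * V1 F)"
      by (metis reshape_mat_id)
    then have "compressed (k - 1) (U1 F * R11 F)"
      using KV isoKV by (auto simp: compressed_def)
    moreover have "good_step k Y F" unfolding good_step_def B using F err by simp
    ultimately show ?thesis by blast
  qed
  \<comment> \<open>The choice runs upwards, so the matrix of step \<open>k\<close> gets the number \<open>n = d - k\<close>.\<close>
  let ?P = "\<lambda>n Y. (n = 0 \<longrightarrow> Y = A (d - 1)) \<and> (n < d \<longrightarrow> compressed (d - n) Y)"
  let ?Q = "\<lambda>n Y Y'. n + 2 \<le> d \<longrightarrow> (\<exists>F. good_step (d - n) Y F \<and> Y' = U1 F * R11 F)"
  have first: "\<exists>Y. ?P 0 Y" using start by auto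
  have next_one: "\<exists>Y'. ?P (Suc n) Y' \<and> ?Q n Y Y'" if "?P n Y" for n Y
  proof (cases "n + 2 \<le> d")
    case True
    then have "d - n \<in> {2..d}" "compressed (d - n) Y" using that by auto
    from step[OF this] show ?thesis by auto
  next
    case False
    then show ?thesis by auto
  qed
  have "\<exists>f. \<forall>n. ?P n (f n) \<and> ?Q n (f n) (f (Suc n))"
    by (rule dependent_nat_choice[OF first next_one])
  then obtain f where f: "\<And>n. ?P n (f n)" "\<And>n. ?Q n (f n) (f (Suc n))"
    by metis
  define C where "C k = f (d - k)" for k
  have "\<exists>F. good_step k (C k) F \<and> C (k - 1) = U1 F * R11 F" if k: "k \<in> {2..d}" for k
  proof -
    have "d - k + 2 \<le> d" "d - (d - k) = k" "Suc (d - k) = d - (k - 1)" using k by auto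
    then show ?thesis using f(2)[of "d - k"] by (simp add: C_def)
  qed
  then obtain F where F: "\<And>k. k \<in> {2..d} \<Longrightarrow> good_step k (C k) (F k) \<and> C (k - 1) = U1 (F k) * R11 (F k)"
    by metis
  define G where "G k = (if k = 1 then reshape3 (C 1) 1 (I 1) (r 1)
    else reshape3 (transpose_mat (V1 (F k))) (r (k - 1)) (I k) (r k))" for k
  have "C d = A (d - 1)" using f(1)[of 0] by (simp add: C_def)
  then have "tt_urv_run d I r X C F G"
    unfolding tt_urv_run_def using F by (auto simp: G_def A_def N_def good_step_def)
  moreover have "\<forall>k\<in>{2..d}. frob (urv_residual (F k)) \<le> frob (urv_residual (D (k - 1)))"
    using F by (auto simp: good_step_def)
  ultimately show ?thesis by blast
qed

section \<open>The error bound\<close>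

theorem theorem3p2:
  fixes d :: nat and I r :: "nat \<Rightarrow> nat" and X :: tensor
    and D :: "nat \<Rightarrow> urv" and \<epsilon> :: "nat \<Rightarrow> real"
  assumes order: "1 \<le> d"
    and dims: "\<forall>k\<in>{1..d}. 0 < I k"
    and boundary_ranks: "r 0 = 1" "r d = 1"
    and admissible_ranks: "\<forall>k\<in>{2..d}. r (k - 1) \<le> I k * r k"
    and unfolding_urv: "\<forall>k\<in>{1..d-1}. is_urv (unfolding_mat d I X k) (r k) (D k)"
    and unfolding_err: "\<forall>k\<in>{1..d-1}. frob (urv_residual (D k)) = \<epsilon> k"
  shows "(\<exists>C F G. tt_urv_run d I r X C F G \<and>
            (\<forall>k\<in>{2..d}. frob (urv_residual (F k)) \<le> \<epsilon> (k - 1))) \<and>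
         (\<forall>C F G. tt_urv_run d I r X C F G \<and>
            (\<forall>k\<in>{2..d}. frob (urv_residual (F k)) \<le> \<epsilon> (k - 1)) \<longrightarrow>
            tensor_frob d I (\<lambda>i. X i - tt_tensor d r G i) \<le> sqrt (\<Sum>k=1..d-1. (\<epsilon> k)\<^sup>2))"
proof (intro conjI allI impI)
  have "frob (urv_residual (D (k - 1))) = \<epsilon> (k - 1)" if "k \<in> {2..d}" for k
  proof -
    have "k - 1 \<in> {1..d-1}" using that by auto
    then show ?thesis using unfolding_err by blast
  qed
  then show "\<exists>C F G. tt_urv_run d I r X C F G \<and>
      (\<forall>k\<in>{2..d}. frob (urv_residual (F k)) \<le> \<epsilon> (k - 1))"
    using tt_urv_run_exists[of d r I X D] order boundary_ranks admissible_ranks unfolding_urv by auto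
next
  fix C F G
  assume "tt_urv_run d I r X C F G \<and> (\<forall>k\<in>{2..d}. frob (urv_residual (F k)) \<le> \<epsilon> (k - 1))"
  then have run: "tt_urv_run d I r X C F G"
    and err: "\<And>k. k \<in> {2..d} \<Longrightarrow> frob (urv_residual (F k)) \<le> \<epsilon> (k - 1)" by auto
  have "(tensor_frob d I (\<lambda>i. X i - tt_tensor d r G i))\<^sup>2 = (\<Sum>k=2..d. (frob (urv_residual (F k)))\<^sup>2)"
    by (rule tt_urv_error[OF run order boundary_ranks])
  also have "\<dots> \<le> (\<Sum>k=2..d. (\<epsilon> (k - 1))\<^sup>2)"
    by (intro sum_mono power_mono err frob_nonneg)
  also have "\<dots> = (\<Sum>k=1..d-1. (\<epsilon> k)\<^sup>2)"
    by (rule sum.reindex_bij_witness[of _ Suc "\<lambda>k. k - 1"]) auto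
  finally show "tensor_frob d I (\<lambda>i. X i - tt_tensor d r G i) \<le> sqrt (\<Sum>k=1..d-1. (\<epsilon> k)\<^sup>2)"
    by (rule real_le_rsqrt)
qed

end
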